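(* Let $T=(V,E)$ be a finite tree with at least one edge, let $C\subseteq E$ be nonempty, and let $c\in\mathbb R$. Every $p\in\mathcal S_C(c)$ satisfies $$|C|c=\sum_{x\in V,\ E(x)\subseteq C}(2-d_x).$$ In particular, the support $C$ itself determines the only possible value of $c$. Suppose that $G_C$ has connected components (vertex sets) $C_1,\ldots,C_s$ and that $\mathcal S_C(c)$ is nonempty. Then there are uniquely determined vectors $q^{(i)}\in\Delta_{C_i}$ such that $$\mathcal S_C(c)=\left\{\sum_{i=1}^s\theta_iq^{(i)}:\theta_i>0,\ \sum_{i=1}^s\theta_i=1\right\}.$$ When $G_C$ is connected, $\mathcal S_C(c)$ is a single point; otherwise it is an open simplex of dimension $s-1$. Now let $w(t)$ be a solution of the normalized inverse-weight Ricci flow on $T$ with positive initial metric, and let $w^*$ be an omega-limit point of $w$ whose positive support $C=E^+(w^* )$ has maximal cardinality among the positive supports of all omega-limit points of $w$. If $G_C$ is connected, then $w(t)\to w^*$ as $t\to\infty$. In particular, this conclusion holds if $E^+(w^* )=E_*$ and $G_{E_*}$ is connected.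
   Context: $T=(V,E)$ is a finite tree with at least one edge; $d_x$ is the combinatorial degree of $x\in V$ and $E(x)$ the set of edges incident to $x$. A positive metric is $w=(w_e)_{e\in E}$ with all $w_e>0$; it induces the path metric $d_w$ on $V$. Put $D_x(w)=\sum_{e\ni x}1/w_e$. For $\alpha\in[0,1)$ let $m_x^\alpha(x)=\alpha$ and $m_x^\alpha(z)=(1-\alpha)\,w_{xz}^{-1}/D_x(w)$ for $z\sim x$. The (inverse-weight) Lin--Lu--Yau curvature of $e=xy$ is $\kappa_e(w)=\lim_{\alpha\uparrow1}\frac{1-W_1(m_x^\alpha,m_y^\alpha)/w_e}{1-\alpha}$, with $W_1$ the $1$-Wasserstein distance for $d_w$. Known formula on trees: $\kappa_{xy}(w)=\frac{2-d_x}{w_{xy}D_x(w)}+\frac{2-d_y}{w_{xy}D_y(w)}$. The normalized flow is $\dot w_e=-w_e(\kappa_e(w)-K(w))$, $K(w)=\sum_f w_f\kappa_f(w)$, with $w_e(0)>0$ and $\sum_e w_e(0)=1$ (this sum is preserved). For every positive initial metric the limits $c_e=\lim_{t\to\infty}\kappa_e(w(t))$ exist; put $c_*=\min_e c_e$ and $E_*=\{e\in E:c_e=c_*\}$. An omega-limit point of $w$ is a point $w^*\in\{q\in\mathbb R^E:q_e\ge0,\sum_e q_e=1\}$ such that $w(t_j)\to w^*$ for some sequence $t_j\to\infty$; its positive support is $E^+(w^* )=\{e\in E:w^*_e>0\}$. For nonempty $C\subseteq E$ let $\Delta_C=\{p\in\mathbb R^C:p_e>0\ \forall e\in C,\ \sum_{e\in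 C}p_e=1\}$, whose elements are identified with vectors in $\mathbb R^E$ (or $\mathbb R^{C'}$ for $C'\supseteq C$) by extending by $0$. For $p\in\Delta_C$ and $e\in C$ put $$\kappa_e^C(p)=\sum_{x\in e,\ E(x)\subseteq C}\frac{2-d_x}{p_e\sum_{f\in E(x)}p_f^{-1}},$$ and for $c\in\mathbb R$ let $\mathcal S_C(c)=\{p\in\Delta_C:\kappa_e^C(p)=c\text{ for every }e\in C\}$. $G_C$ is the graph whose vertices are the edges in $C$, two of them being adjacent if they meet at a vertex $x$ with $d_x\ge3$ and $E(x)\subseteq C$. *)

theory Defs
  imports "HOL-Analysis.Analysis"
begin

section \<open>Graphs given by an adjacency relation\<close>

definition gwalk :: "'a set \<Rightarrow> ('a \<Rightarrow> 'a \<Rightarrow> bool) \<Rightarrow> 'a list \<Rightarrow> bool" where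
  "gwalk A R p \<longleftrightarrow> p \<noteq> [] \<and> set p \<subseteq> A \<and> successively R p"

definition gwalk_betw :: "'a set \<Rightarrow> ('a \<Rightarrow> 'a \<Rightarrow> bool) \<Rightarrow> 'a \<Rightarrow> 'a list \<Rightarrow> 'a \<Rightarrow> bool" where
  "gwalk_betw A R x p y \<longleftrightarrow> gwalk A R p \<and> hd p = x \<and> last p = y"

definition gconnected :: "'a set \<Rightarrow> ('a \<Rightarrow> 'a \<Rightarrow> bool) \<Rightarrow> bool" where
  "gconnected A R \<longleftrightarrow> A \<noteq> {} \<and> (\<forall>x\<in>A. \<forall>y\<in>A. \<exists>p. gwalk_betw A R x p y)"

definition gcomponents :: "'a set \<Rightarrow> ('a \<Rightarrow> 'a \<Rightarrow> bool) \<Rightarrow> 'a set set" where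
  "gcomponents A R = {{y \<in> A. \<exists>p. gwalk_betw A R x p y} | x. x \<in> A}"

text \<open>A cycle is the list of its distinct vertices, of which there are at least three.\<close>

definition gcycle :: "'a set \<Rightarrow> ('a \<Rightarrow> 'a \<Rightarrow> bool) \<Rightarrow> 'a list \<Rightarrow> bool" where
  "gcycle A R p \<longleftrightarrow> gwalk A R p \<and> distinct p \<and> length p \<ge> 3 \<and> R (last p) (hd p)"

section \<open>Finite trees\<close>

text \<open>
  A finite simple graph \<open>T = (V, E)\<close> with at least one edge is given by finite types \<open>'v\<close>
  of vertices and \<open>'e\<close> of edges (all elements of these types belong to the graph) and a map
  sending each edge to its two-element set of end points, no two edges having the same end
  points. So \<open>\<real>\<^sup>E\<close> is the Euclidean space \<open>real ^ 'e\<close>.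
\<close>

definition adj :: "('e \<Rightarrow> 'v set) \<Rightarrow> 'v \<Rightarrow> 'v \<Rightarrow> bool" where
  "adj ends x y \<longleftrightarrow> (\<exists>e. ends e = {x, y})"

definition finite_tree :: "('e::finite \<Rightarrow> 'v::finite set) \<Rightarrow> bool" where
  "finite_tree ends \<longleftrightarrow>
     (\<forall>e. card (ends e) = 2) \<and> inj ends \<and>
     gconnected UNIV (adj ends) \<and> (\<nexists>p. gcycle UNIV (adj ends) p)"

definition edges_at :: "('e \<Rightarrow> 'v set) \<Rightarrow> 'v \<Rightarrow> 'e set" where
  "edges_at ends x = {e. x \<in> ends e}"

definition deg :: "('e \<Rightarrow> 'v set) \<Rightarrow> 'v \<Rightarrow> nat" where
  "deg ends x = card (edges_at ends x)"

text \<open>Only meaningful for adjacent vertices.\<close>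

definition edge_betw :: "('e \<Rightarrow> 'v set) \<Rightarrow> 'v \<Rightarrow> 'v \<Rightarrow> 'e" where
  "edge_betw ends x y = (THE e. ends e = {x, y})"

section \<open>Path metric and Wasserstein distance\<close>

definition walk_length :: "('e::finite \<Rightarrow> 'v set) \<Rightarrow> real ^ 'e \<Rightarrow> 'v list \<Rightarrow> real" where
  "walk_length ends w p = (\<Sum>i<length p - 1. w $ edge_betw ends (p ! i) (p ! Suc i))"

definition path_dist :: "('e::finite \<Rightarrow> 'v set) \<Rightarrow> real ^ 'e \<Rightarrow> 'v \<Rightarrow> 'v \<Rightarrow> real" where
  "path_dist ends w x y = Inf {walk_length ends w p | p. gwalk_betw UNIV (adj ends) x p y}"

definition couplings :: "('v::finite \<Rightarrow> real) \<Rightarrow> ('v \<Rightarrow> real) \<Rightarrow> ('v \<Rightarrow> 'v \<Rightarrow> real) set" where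
  "couplings \<mu> \<nu> =
     {\<pi>. (\<forall>x y. 0 \<le> \<pi> x y) \<and> (\<forall>x. (\<Sum>y\<in>UNIV. \<pi> x y) = \<mu> x) \<and> (\<forall>y. (\<Sum>x\<in>UNIV. \<pi> x y) = \<nu> y)}"

definition wasserstein1 ::
  "('e::finite \<Rightarrow> 'v::finite set) \<Rightarrow> real ^ 'e \<Rightarrow> ('v \<Rightarrow> real) \<Rightarrow> ('v \<Rightarrow> real) \<Rightarrow> real" where
  "wasserstein1 ends w \<mu> \<nu> =
     Inf {(\<Sum>x\<in>UNIV. \<Sum>y\<in>UNIV. \<pi> x y * path_dist ends w x y) | \<pi>. \<pi> \<in> couplings \<mu> \<nu>}"

section \<open>Inverse-weight Lin--Lu--Yau curvature\<close>

definition inv_weight_sum :: "('e::finite \<Rightarrow> 'v set) \<Rightarrow> real ^ 'e \<Rightarrow> 'v \<Rightarrow> real" where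
  "inv_weight_sum ends w x = (\<Sum>e\<in>edges_at ends x. 1 / w $ e)"

definition lazy_measure ::
  "('e::finite \<Rightarrow> 'v set) \<Rightarrow> real ^ 'e \<Rightarrow> real \<Rightarrow> 'v \<Rightarrow> 'v \<Rightarrow> real" where
  "lazy_measure ends w \<alpha> x z =
     (if z = x then \<alpha>
      else if adj ends x z
        then (1 - \<alpha>) * inverse (w $ edge_betw ends x z) / inv_weight_sum ends w x
      else 0)"

text \<open>
  An edge is an unordered pair of end points \<open>x\<close>, \<open>y\<close>; the expression in the limit is
  symmetric in them, so the limit is taken for both orders.
\<close>

definition curvature :: "('e::finite \<Rightarrow> 'v::finite set) \<Rightarrow> real ^ 'e \<Rightarrow> 'e \<Rightarrow> real" where
  "curvature ends w e =
     (THE k. \<forall>x y. ends e = {x, y} \<longrightarrow>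
        ((\<lambda>\<alpha>. (1 - wasserstein1 ends w (lazy_measure ends w \<alpha> x) (lazy_measure ends w \<alpha> y) / w $ e)
              / (1 - \<alpha>)) \<longlongrightarrow> k) (at_left 1))"

definition total_curvature :: "('e::finite \<Rightarrow> 'v::finite set) \<Rightarrow> real ^ 'e \<Rightarrow> real" where
  "total_curvature ends w = (\<Sum>f\<in>UNIV. w $ f * curvature ends w f)"

section \<open>The normalized flow and its limits\<close>

text \<open>A solution is defined for all times \<open>t \<ge> 0\<close> and stays in the space of positive metrics.\<close>

definition normalized_flow ::
  "('e::finite \<Rightarrow> 'v::finite set) \<Rightarrow> (real \<Rightarrow> real ^ 'e) \<Rightarrow> bool" where
  "normalized_flow ends w \<longleftrightarrow>
     (\<forall>t\<ge>0. \<forall>e. 0 < w t $ e) \<and> (\<Sum>e\<in>UNIV. w 0 $ e) = 1 \<and>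
     (\<forall>t\<ge>0. (w has_vector_derivative
        (\<chi> e. - (w t $ e * (curvature ends (w t) e - total_curvature ends (w t)))))
        (at t within {0..}))"

definition omega_limit_point :: "(real \<Rightarrow> real ^ 'e::finite) \<Rightarrow> real ^ 'e \<Rightarrow> bool" where
  "omega_limit_point w q \<longleftrightarrow>
     (\<forall>e. 0 \<le> q $ e) \<and> (\<Sum>e\<in>UNIV. q $ e) = 1 \<and>
     (\<exists>\<tau>::nat \<Rightarrow> real. filterlim \<tau> at_top sequentially \<and> (\<lambda>j. w (\<tau> j)) \<longlonglongrightarrow> q)"

definition pos_support :: "real ^ 'e::finite \<Rightarrow> 'e set" where
  "pos_support q = {e. 0 < q $ e}"

definition limit_curvature ::
  "('e::finite \<Rightarrow> 'v::finite set) \<Rightarrow> (real \<Rightarrow> real ^ 'e) \<Rightarrow> 'e \<Rightarrow> real" where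
  "limit_curvature ends w e = Lim at_top (\<lambda>t. curvature ends (w t) e)"

definition min_limit_edges ::
  "('e::finite \<Rightarrow> 'v::finite set) \<Rightarrow> (real \<Rightarrow> real ^ 'e) \<Rightarrow> 'e set" where
  "min_limit_edges ends w =
     {e. limit_curvature ends w e = Min (range (limit_curvature ends w))}"

section \<open>Metrics of constant curvature supported on a set of edges\<close>

text \<open>Elements of \<open>\<Delta>\<^sub>C\<close> are extended by \<open>0\<close> outside of \<open>C\<close>.\<close>

definition simplex_on :: "'e set \<Rightarrow> (real ^ 'e::finite) set" where
  "simplex_on C = {p. (\<forall>e\<in>C. 0 < p $ e) \<and> (\<forall>e. e \<notin> C \<longrightarrow> p $ e = 0) \<and> (\<Sum>e\<in>C. p $ e) = 1}"

definition curvature_on ::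
  "('e::finite \<Rightarrow> 'v::finite set) \<Rightarrow> 'e set \<Rightarrow> real ^ 'e \<Rightarrow> 'e \<Rightarrow> real" where
  "curvature_on ends C p e =
     (\<Sum>x \<in> {x \<in> ends e. edges_at ends x \<subseteq> C}.
        (2 - real (deg ends x)) / (p $ e * (\<Sum>f\<in>edges_at ends x. inverse (p $ f))))"

definition const_curv_set ::
  "('e::finite \<Rightarrow> 'v::finite set) \<Rightarrow> 'e set \<Rightarrow> real \<Rightarrow> (real ^ 'e) set" where
  "const_curv_set ends C c = {p \<in> simplex_on C. \<forall>e\<in>C. curvature_on ends C p e = c}"

text \<open>Adjacency of the graph \<open>G\<^sub>C\<close>, whose vertex set is \<open>C\<close>.\<close>

definition GC_adj :: "('e \<Rightarrow> 'v set) \<Rightarrow> 'e set \<Rightarrow> 'e \<Rightarrow> 'e \<Rightarrow> bool" where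
  "GC_adj ends C e f \<longleftrightarrow>
     e \<in> C \<and> f \<in> C \<and> e \<noteq> f \<and>
     (\<exists>x. x \<in> ends e \<and> x \<in> ends f \<and> 3 \<le> deg ends x \<and> edges_at ends x \<subseteq> C)"

end

theory Submission
  imports Defs
begin

text \<open>
  On a tree an explicit potential and an explicit coupling show that the curvature of \<open>e\<close> is the sum
  over its ends of \<open>(2 - d\<^sub>x) / (w\<^sub>e D\<^sub>x)\<close>. In the coordinates \<open>y\<^sub>e = - ln w\<^sub>e\<close> it is the
  \<open>e\<close>-component of the gradient of the concave function
  \<open>\<Phi>(y) = \<Sum>\<^sub>x (2 - d\<^sub>x) ln (\<Sum>\<^sub>f exp y\<^sub>f)\<close>, which is unchanged when a multiple of \<open>(1, \<dots>, 1)\<close>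
  is added to \<open>y\<close>; so up to such shifts the normalized flow is the gradient flow of \<open>\<Phi>\<close>, and the gradient
  of a concave function converges along its gradient flow.

  Two metrics of the same constant curvature on \<open>C\<close> are proportional on each component of \<open>G\<^sub>C\<close>, by a
  maximum principle for their ratio, and rescaling the components separately does not change the
  curvature. Every omega-limit point has constant curvature on its support, so one whose support \<open>C\<close>
  is of maximal size with \<open>G\<^sub>C\<close> connected is isolated among the omega-limit points of the bounded
  trajectory.
\<close>

section \<open>Potentials on trees\<close>

text \<open>\<Phi> need not attain its supremum, and the trajectory may then run off to infinity in
  the coordinates y. Concavity therefore controls only the velocity, whose limit is the vector of
  the c_e, and the metric has to be recovered from it. Differences of the c_e act as exponential
  rates: if c_e > c_f, then w_e / w_f decays exponentially, so every omega-limit point is supported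
  inside E_*, usually on the boundary of the simplex. When an edge at x dies out, its inverse weight
  blows up and x stops contributing to the curvature of the surviving edges at x; this is why only
  vertices with all their edges in C count. Among those, a vertex of degree 2 contributes 0 and a
  leaf contributes the constant 1, so weights influence each other only at vertices of degree at
  least 3, which is the adjacency of \<open>GC_adj\<close>. Acyclicity enters through the curvature
  formula: without cycles, the slopes of a Kantorovich potential can be prescribed freely on the
  edges.\<close>

lemma rtranclp_distinct_path:
  assumes "R\<^sup>*\<^sup>* x y"
  shows "\<exists>p. p \<noteq> [] \<and> hd p = x \<and> last p = y \<and> distinct p \<and> successively R p"
  using assms
proof (induction rule: rtranclp_induct)
  case base
  show ?case by (intro exI[of _ "[x]"]) auto
next
  case (step y z)
  then obtain p where p: "p \<noteq> []" "hd p = x" "last p = y" "distinct p" "successively R p"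
    by blast
  show ?case
  proof (cases "z \<in> set p")
    case True
    \<comment> \<open>The step returns to a vertex already visited: the path is cut at
      \<open>z\<close> instead of extended, which keeps it free of repetitions.\<close>
    then obtain us vs where us: "p = us @ z # vs" by (meson split_list)
    then have "successively R (us @ [z])" "distinct (us @ [z])"
      using p by (auto simp: successively_append_iff)
    moreover have "hd (us @ [z]) = x" using p(2) us by (cases us) auto
    ultimately show ?thesis by (intro exI[of _ "us @ [z]"]) auto
  next
    case False
    then show ?thesis using p step.hyps
      by (intro exI[of _ "p @ [z]"]) (auto simp: successively_append_iff)
  qed
qed

text \<open>The step distribution of the walk without laziness. Mixing it with a point mass gives
  \<open>lazy_measure\<close>, which makes the dependence on \<alpha> affine.\<close>

definition nbr_mass :: "('e::finite \<Rightarrow> 'v set) \<Rightarrow> real ^ 'e \<Rightarrow> 'v \<Rightarrow> 'v \<Rightarrow> real" where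
  "nbr_mass ends w x z =
     (if adj ends x z then inverse (w $ edge_betw ends x z) / inv_weight_sum ends w x else 0)"

context
  fixes ends :: "'e::finite \<Rightarrow> 'v::finite set"
  assumes tree: "finite_tree ends"
begin

lemma card_ends: "card (ends e) = 2" and inj_ends: "inj ends"
  using tree by (auto simp: finite_tree_def)

lemma ends_pairE:
  obtains x y where "ends e = {x, y}" "x \<noteq> y"
  using card_ends[of e] by (auto simp: card_2_iff)

lemma ends_pair_neq: "ends e = {x, y} \<Longrightarrow> x \<noteq> y"
  using card_ends[of e] by auto

lemma edge_betw_eq: "ends e = {x, y} \<Longrightarrow> edge_betw ends x y = e"
  unfolding edge_betw_def using inj_ends by (intro the_equality) (auto dest: injD)

lemma edge_betw_ends: "adj ends x y \<Longrightarrow> ends (edge_betw ends x y) = {x, y}"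
  using edge_betw_eq unfolding adj_def by metis

lemma edge_betw_commute: "edge_betw ends x y = edge_betw ends y x"
  by (simp add: edge_betw_def insert_commute)

lemma adj_commute: "adj ends x y \<longleftrightarrow> adj ends y x"
  by (simp add: adj_def insert_commute)

lemma adj_irrefl: "\<not> adj ends x x"
  using ends_pair_neq by (auto simp: adj_def)

text \<open>Measures live on neighbours, while degrees and inverse-weight sums are taken over edges;
  this bijection translates between them.\<close>

lemma bij_betw_neighbours_edges: "bij_betw (edge_betw ends x) {z. adj ends x z} (edges_at ends x)"
proof (rule bij_betwI')
  fix y z assume "y \<in> {z. adj ends x z}" "z \<in> {z. adj ends x z}"
  then show "edge_betw ends x y = edge_betw ends x z \<longleftrightarrow> y = z"
    using edge_betw_ends[of x y] edge_betw_ends[of x z] by (auto simp: doubleton_eq_iff)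
next
  fix y assume "y \<in> {z. adj ends x z}"
  then show "edge_betw ends x y \<in> edges_at ends x"
    using edge_betw_ends by (auto simp: edges_at_def)
next
  fix e assume e: "e \<in> edges_at ends x"
  obtain a b where ab: "ends e = {a, b}" by (rule ends_pairE)
  then have "x = a \<or> x = b" using e by (auto simp: edges_at_def)
  then obtain y where "ends e = {x, y}" using ab by (metis insert_commute)
  then show "\<exists>y\<in>{z. adj ends x z}. e = edge_betw ends x y"
    using edge_betw_eq[of e x y] by (intro bexI[of _ y]) (auto simp: adj_def)
qed

lemma sum_neighbours:
  "(\<Sum>z | adj ends x z. F (edge_betw ends x z)) = (\<Sum>e\<in>edges_at ends x. F e)"
  by (rule sum.reindex_bij_betw[OF bij_betw_neighbours_edges])

text \<open>\<open>S\<close> is what can be reached from \<open>b\<close> without using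
  \<open>g\<close>. If it contained \<open>a\<close>, a path from \<open>b\<close> to
  \<open>a\<close> avoiding \<open>g\<close> would close up with \<open>g\<close> to a
  cycle.\<close>

lemma edge_cut:
  assumes g: "ends g = {a, b}"
  obtains S where "b \<in> S" "a \<notin> S" "\<And>h u v. h \<noteq> g \<Longrightarrow> ends h = {u, v} \<Longrightarrow> u \<in> S \<longleftrightarrow> v \<in> S"
proof -
  define R where "R u v \<longleftrightarrow> (\<exists>h. h \<noteq> g \<and> ends h = {u, v})" for u v
  define S where "S = {v. R\<^sup>*\<^sup>* b v}"
  have "a \<notin> S"
  proof
    assume "a \<in> S"
    then obtain p where p: "p \<noteq> []" "hd p = b" "last p = a" "distinct p" "successively R p"
      using rtranclp_distinct_path[of R b a] by (auto simp: S_def)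
    have "adj ends u v" if "R u v" for u v using that by (auto simp: R_def adj_def)
    then have "successively (adj ends) p" using p(5) by (metis successively_mono)
    \<comment> \<open>A path with one vertex would make \<open>g\<close> a loop, and one with two
      vertices would use a second edge with the ends of \<open>g\<close>, against injectivity of
      \<open>ends\<close>.\<close>
    moreover have "length p \<ge> 3"
    proof (rule ccontr)
      assume "\<not> length p \<ge> 3"
      then consider u where "p = [u]" | u v where "p = [u, v]"
        using p(1) by (cases p rule: remdups_adj.cases) (auto simp: numeral_3_eq_3 Suc_le_eq)
      then show False
      proof cases
        case 1
        then show ?thesis using p ends_pair_neq[OF g] by auto
      next
        case 2
        then have "R b a" using p by auto
        then show ?thesis using g inj_ends unfolding R_def
          by (metis injD insert_commute)
      qed
    qed
    moreover have "adj ends (last p) (hd p)" using p g by (auto simp: adj_def)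
    ultimately have "gcycle UNIV (adj ends) p" using p by (auto simp: gcycle_def gwalk_def)
    then show False using tree by (auto simp: finite_tree_def)
  qed
  moreover have "b \<in> S" by (simp add: S_def)
  moreover have "u \<in> S \<longleftrightarrow> v \<in> S" if "h \<noteq> g" "ends h = {u, v}" for h u v
  proof -
    have "R u v" "R v u" using that by (auto simp: R_def insert_commute)
    then show ?thesis by (auto simp: S_def intro: rtranclp.rtrancl_into_rtrancl)
  qed
  ultimately show ?thesis using that by blast
qed

text \<open>Without cycles there is no compatibility condition. Each edge \<open>g\<close> splits
  the tree into two sides, and \<open>f v\<close> adds up the increments of all \<open>g\<close>
  whose side \<open>S g\<close> contains \<open>v\<close>; crossing an edge changes membership only
  in its own side.\<close>

lemma tree_potential:
  fixes \<phi> :: "'v \<Rightarrow> 'v \<Rightarrow> real"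
  assumes anti: "\<And>u v. \<phi> u v = - \<phi> v u"
  obtains f where "\<And>u v. adj ends u v \<Longrightarrow> f v - f u = \<phi> u v"
proof -
  define cut where "cut g a b S \<longleftrightarrow> ends g = {a, b} \<and> b \<in> S \<and> a \<notin> S \<and>
      (\<forall>h u v. h \<noteq> g \<longrightarrow> ends h = {u, v} \<longrightarrow> (u \<in> S \<longleftrightarrow> v \<in> S))" for g a b S
  have "\<exists>a b S. cut g a b S" for g
  proof -
    obtain a b where ab: "ends g = {a, b}" by (rule ends_pairE)
    show ?thesis
    proof (rule edge_cut[OF ab])
      fix S assume "b \<in> S" "a \<notin> S" "\<And>h u v. h \<noteq> g \<Longrightarrow> ends h = {u, v} \<Longrightarrow> u \<in> S \<longleftrightarrow> v \<in> S"
      then have "cut g a b S" using ab unfolding cut_def by blast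
      then show ?thesis by blast
    qed
  qed
  then obtain a b S where abS: "\<And>g. cut g (a g) (b g) (S g)" by metis
  have *: "ends g = {a g, b g} \<and> b g \<in> S g \<and> a g \<notin> S g"
    and cut: "h \<noteq> g \<Longrightarrow> ends h = {u, v} \<Longrightarrow> u \<in> S g \<longleftrightarrow> v \<in> S g" for g h u v
    using abS[of g] unfolding cut_def by blast+
  define f where "f v = (\<Sum>g\<in>UNIV. \<phi> (a g) (b g) * of_bool (v \<in> S g))" for v
  have "f v - f u = \<phi> u v" if "adj ends u v" for u v
  proof -
    obtain g where g: "ends g = {u, v}" using \<open>adj ends u v\<close> unfolding adj_def by blast
    have "f v - f u = (\<Sum>h\<in>UNIV. \<phi> (a h) (b h) * (of_bool (v \<in> S h) - of_bool (u \<in> S h)))"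
      by (simp add: f_def algebra_simps sum_subtractf)
    also have "\<dots> = (\<Sum>h\<in>{g}. \<phi> (a h) (b h) * (of_bool (v \<in> S h) - of_bool (u \<in> S h)))"
    proof (rule sum.mono_neutral_right)
      have "u \<in> S h \<longleftrightarrow> v \<in> S h" if "h \<noteq> g" for h using cut[of g h u v] cut[of h g u v] g that by blast
      then show "\<forall>h\<in>UNIV - {g}. \<phi> (a h) (b h) * (of_bool (v \<in> S h) - of_bool (u \<in> S h)) = 0"
        by simp
    qed auto
    also have "\<dots> = \<phi> u v"
    proof -
      have "{a g, b g} = {u, v}" using * g by metis
      then consider "a g = u" "b g = v" | "a g = v" "b g = u"
        by (auto simp: doubleton_eq_iff)
      then show ?thesis
        by cases (use *[of g] anti[of u v] in auto)
    qed
    finally show ?thesis .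
  qed
  then show ?thesis using that by blast
qed

section \<open>The curvature formula\<close>

lemma walk_length_Cons:
  "p \<noteq> [] \<Longrightarrow> walk_length ends w (x # p) = w $ edge_betw ends x (hd p) + walk_length ends w p"
  by (cases p) (simp_all add: walk_length_def sum.lessThan_Suc_shift del: sum.lessThan_Suc)

lemma walk_length_single: "walk_length ends w [x] = 0"
  by (simp add: walk_length_def)

lemma walk_length_nonneg: "(\<And>e. 0 < w $ e) \<Longrightarrow> 0 \<le> walk_length ends w p"
  unfolding walk_length_def by (intro sum_nonneg) (simp add: less_imp_le)

lemma path_dist_le:
  assumes "\<And>e. 0 < w $ e" "gwalk_betw UNIV (adj ends) x p y"
  shows "path_dist ends w x y \<le> walk_length ends w p"
proof -
  have "bdd_below {walk_length ends w p | p. gwalk_betw UNIV (adj ends) x p y}"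
    using walk_length_nonneg[OF assms(1)] by (intro bdd_belowI[where m = 0]) blast
  then show ?thesis unfolding path_dist_def using assms(2) by (intro cInf_lower) blast
qed

text \<open>Telescoping along a walk turns the bound on edges into one on distances. Connectedness
  enters because an infimum over no walks would carry no information.\<close>

lemma path_dist_ge:
  assumes lip: "\<And>u v. adj ends u v \<Longrightarrow> f u - f v \<le> w $ edge_betw ends u v"
  shows "f x - f y \<le> path_dist ends w x y"
  unfolding path_dist_def
proof (rule cInf_greatest)
  show "{walk_length ends w p |p. gwalk_betw UNIV (adj ends) x p y} \<noteq> {}"
    using tree by (auto simp: finite_tree_def gconnected_def)
next
  have *: "f (hd p) - f (last p) \<le> walk_length ends w p" if "p \<noteq> []" "successively (adj ends) p" for p
    using that
  proof (induction p)
    case (Cons u p)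
    show ?case
    proof (cases "p = []")
      case False
      then have "adj ends u (hd p)" "successively (adj ends) p"
        using Cons.prems by (auto simp: successively_Cons)
      then show ?thesis using Cons.IH False lip[of u "hd p"] by (simp add: walk_length_Cons)
    qed (simp add: walk_length_single)
  qed simp
  fix l assume "l \<in> {walk_length ends w p |p. gwalk_betw UNIV (adj ends) x p y}"
  then show "f x - f y \<le> l" using * by (auto simp: gwalk_betw_def gwalk_def)
qed

lemma path_dist_refl_le:
  assumes "\<And>e. 0 < w $ e"
  shows "path_dist ends w x x \<le> 0"
proof -
  have "gwalk_betw UNIV (adj ends) x [x] x" by (simp add: gwalk_betw_def gwalk_def)
  from path_dist_le[OF assms this] show ?thesis by (simp add: walk_length_single)
qed

lemma path_dist_edge_le:
  assumes "\<And>e. 0 < w $ e" "adj ends x y"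
  shows "path_dist ends w x y \<le> w $ edge_betw ends x y"
proof -
  have "gwalk_betw UNIV (adj ends) x [x, y] y"
    using assms(2) by (simp add: gwalk_betw_def gwalk_def)
  from path_dist_le[OF assms(1) this] show ?thesis
    by (simp add: walk_length_single walk_length_Cons)
qed

text \<open>Upper bounds for walks of at most two edges suffice: the coupling used for an edge
  \<open>xy\<close> moves mass only from neighbours of \<open>x\<close> to \<open>y\<close>, from
  \<open>x\<close> to neighbours of \<open>y\<close>, and from \<open>x\<close> to
  \<open>y\<close>.\<close>

lemma path_dist_two_edges_le:
  assumes "\<And>e. 0 < w $ e" "adj ends x y" "adj ends y z"
  shows "path_dist ends w x z \<le> w $ edge_betw ends x y + w $ edge_betw ends y z"
proof -
  have "gwalk_betw UNIV (adj ends) x [x, y, z] z"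
    using assms(2,3) by (simp add: gwalk_betw_def gwalk_def)
  from path_dist_le[OF assms(1) this] show ?thesis
    by (simp add: walk_length_single walk_length_Cons)
qed

section \<open>Transport certificates and the lazy measures\<close>

lemma coupling_cost:
  fixes f :: "'v \<Rightarrow> real"
  assumes "\<pi> \<in> couplings \<mu> \<nu>"
  shows "(\<Sum>x\<in>UNIV. \<Sum>y\<in>UNIV. \<pi> x y * (f x - f y)) = (\<Sum>x\<in>UNIV. f x * \<mu> x) - (\<Sum>y\<in>UNIV. f y * \<nu> y)"
proof -
  have "(\<Sum>x\<in>UNIV. \<Sum>y\<in>UNIV. \<pi> x y * (f x - f y))
      = (\<Sum>x\<in>UNIV. \<Sum>y\<in>UNIV. f x * \<pi> x y) - (\<Sum>x\<in>UNIV. \<Sum>y\<in>UNIV. f y * \<pi> x y)"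
    by (simp add: algebra_simps sum_subtractf)
  also have "(\<Sum>x\<in>UNIV. \<Sum>y\<in>UNIV. f y * \<pi> x y) = (\<Sum>y\<in>UNIV. \<Sum>x\<in>UNIV. f y * \<pi> x y)"
    by (rule sum.swap)
  finally show ?thesis using assms
    by (simp add: couplings_def flip: sum_distrib_left)
qed

text \<open>Kantorovich duality, with the complementary slackness condition as hypothesis.\<close>

lemma wasserstein1_eq_potential:
  assumes lip: "\<And>u v. adj ends u v \<Longrightarrow> f u - f v \<le> w $ edge_betw ends u v"
    and \<pi>: "\<pi> \<in> couplings \<mu> \<nu>"
    and opt: "\<And>u v. \<pi> u v \<noteq> 0 \<Longrightarrow> path_dist ends w u v \<le> f u - f v"
  shows "wasserstein1 ends w \<mu> \<nu> = (\<Sum>x\<in>UNIV. f x * \<mu> x) - (\<Sum>y\<in>UNIV. f y * \<nu> y)"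
    (is "_ = ?d")
proof -
  let ?cost = "\<lambda>\<pi>. \<Sum>x\<in>UNIV. \<Sum>y\<in>UNIV. \<pi> x y * path_dist ends w x y"
  have lower: "?d \<le> ?cost \<rho>" if "\<rho> \<in> couplings \<mu> \<nu>" for \<rho>
  proof -
    have "\<rho> x y * (f x - f y) \<le> \<rho> x y * path_dist ends w x y" for x y
      using that path_dist_ge[OF lip] by (intro mult_left_mono) (auto simp: couplings_def)
    then show ?thesis unfolding coupling_cost[OF that, symmetric] by (intro sum_mono) auto
  qed
  have "\<pi> x y * path_dist ends w x y \<le> \<pi> x y * (f x - f y)" for x y
    using opt[of x y] \<pi> by (cases "\<pi> x y = 0") (auto simp: couplings_def intro!: mult_left_mono)
  then have "?cost \<pi> \<le> ?d" unfolding coupling_cost[OF \<pi>, symmetric] by (intro sum_mono) auto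
  then have "?cost \<pi> = ?d" using lower[OF \<pi>] by simp
  then show ?thesis unfolding wasserstein1_def using \<pi> lower
    by (intro cInf_eq_minimum) (auto intro: sym)
qed

lemma inv_weight_sum_pos:
  assumes "\<And>e. 0 < w $ e" "adj ends x y"
  shows "0 < inv_weight_sum ends w x"
proof -
  have "edge_betw ends x y \<in> edges_at ends x"
    using edge_betw_ends[OF assms(2)] by (auto simp: edges_at_def)
  then show ?thesis unfolding inv_weight_sum_def using assms(1) by (intro sum_pos) auto
qed

lemma lazy_measure_eq:
  "lazy_measure ends w \<alpha> x z = \<alpha> * of_bool (z = x) + (1 - \<alpha>) * nbr_mass ends w x z"
  using adj_irrefl by (auto simp: lazy_measure_def nbr_mass_def)

lemma nbr_mass_nonneg: "(\<And>e. 0 < w $ e) \<Longrightarrow> 0 \<le> nbr_mass ends w x z"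
  using inv_weight_sum_pos[of w x z] by (auto simp: nbr_mass_def intro!: divide_nonneg_pos less_imp_le)

lemma sum_nbr_mass:
  "(\<Sum>z\<in>UNIV. nbr_mass ends w x z * F z) =
     (\<Sum>z | adj ends x z. inverse (w $ edge_betw ends x z) / inv_weight_sum ends w x * F z)"
proof -
  have "(\<Sum>z\<in>UNIV. nbr_mass ends w x z * F z) = (\<Sum>z\<in>{z. adj ends x z}. nbr_mass ends w x z * F z)"
    by (rule sum.mono_neutral_right) (auto simp: nbr_mass_def)
  then show ?thesis by (simp add: nbr_mass_def)
qed

lemma sum_nbr_mass_1:
  assumes "\<And>e. 0 < w $ e" "adj ends x y"
  shows "(\<Sum>z\<in>UNIV. nbr_mass ends w x z) = 1"
proof -
  have "(\<Sum>z\<in>UNIV. nbr_mass ends w x z) = (\<Sum>e\<in>edges_at ends x. inverse (w $ e) / inv_weight_sum ends w x)"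
    using sum_nbr_mass[of w x "\<lambda>_. 1"]
      sum_neighbours[of "\<lambda>e. inverse (w $ e) / inv_weight_sum ends w x" x] by simp
  also have "\<dots> = 1" using inv_weight_sum_pos[OF assms]
    unfolding sum_divide_distrib[symmetric] by (simp add: inv_weight_sum_def inverse_eq_divide)
  finally show ?thesis .
qed

text \<open>The increment \<open>s\<close> times the length of an edge cancels against its inverse
  weight, so every neighbour contributes \<open>s\<close> or \<open>- s\<close> divided by the
  inverse-weight sum. There are \<open>deg - 1\<close> positive terms and one negative one, towards
  \<open>y\<close>.\<close>

lemma lazy_measure_drift:
  fixes f :: "'v \<Rightarrow> real"
  assumes w: "\<And>e. 0 < w $ e" and xy: "adj ends x y"
    and f: "\<And>z. adj ends x z \<Longrightarrow> f z - f x = (if z = y then - s else s) * w $ edge_betw ends x z"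
  shows "(\<Sum>z\<in>UNIV. f z * lazy_measure ends w \<alpha> x z) =
    f x + (1 - \<alpha>) * (s * (real (deg ends x) - 2) / inv_weight_sum ends w x)"
proof -
  define A where "A = s * (real (deg ends x) - 2) / inv_weight_sum ends w x"
  have deg: "card {z. adj ends x z} = deg ends x"
    using bij_betw_same_card[OF bij_betw_neighbours_edges] by (simp add: deg_def)
  have "(\<Sum>z\<in>UNIV. nbr_mass ends w x z * (f z - f x))
      = (\<Sum>z | adj ends x z. (if z = y then - s else s) / inv_weight_sum ends w x)"
  proof -
    have "w $ e' \<noteq> 0" for e' using w[of e'] by simp
    then show ?thesis unfolding sum_nbr_mass by (intro sum.cong) (auto simp: f)
  qed
  also have "\<dots> = (\<Sum>z | adj ends x z. (if z = y then - s else s)) / inv_weight_sum ends w x"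
    by (simp add: sum_divide_distrib)
  also have "(\<Sum>z | adj ends x z. (if z = y then - s else s)) =
      (\<Sum>z | adj ends x z. s - (if z = y then 2 * s else 0))"
    by (intro sum.cong) auto
  also have "\<dots> = s * (real (deg ends x) - 2)"
    using xy by (simp add: sum_subtractf deg algebra_simps)
  finally have *: "(\<Sum>z\<in>UNIV. nbr_mass ends w x z * (f z - f x))
      = A" by (simp only: A_def)
  have "(\<Sum>z\<in>UNIV. f z * lazy_measure ends w \<alpha> x z)
     = (\<Sum>z\<in>UNIV. (if z = x then \<alpha> * f x else 0) + ((1 - \<alpha>) * (nbr_mass ends w x z * (f z - f x))
         + (1 - \<alpha>) * f x * nbr_mass ends w x z))"
    by (intro sum.cong) (auto simp: lazy_measure_eq algebra_simps)
  also have "\<dots> = \<alpha> * f x + ((1 - \<alpha>) * (\<Sum>z\<in>UNIV. nbr_mass ends w x z * (f z - f x))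
       + (1 - \<alpha>) * f x * (\<Sum>z\<in>UNIV. nbr_mass ends w x z))"
    by (simp add: sum.distrib sum_distrib_left)
  also have "\<dots> = \<alpha> * f x + ((1 - \<alpha>) * A + (1 - \<alpha>) * f x * 1)"
    by (simp only: * sum_nbr_mass_1[OF w xy])
  also have "\<dots> = f x + (1 - \<alpha>) * A" by algebra
  finally show ?thesis unfolding A_def .
qed

text \<open>The bound \<open>1/2 \<le> \<alpha>\<close> keeps the mass
  \<open>2 * \<alpha> - 1\<close> moved along \<open>e\<close> nonnegative; the limit concerns only
  \<alpha> near 1. The degree terms are the drifts of one optimal potential at the two ends.\<close>

lemma wasserstein1_lazy_measure:
  assumes w: "\<And>e. 0 < w $ e" and e: "ends e = {x, y}" and \<alpha>: "1/2 \<le> \<alpha>" "\<alpha> \<le> 1"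
  shows "wasserstein1 ends w (lazy_measure ends w \<alpha> x) (lazy_measure ends w \<alpha> y) =
    w $ e + (1 - \<alpha>) * ((real (deg ends x) - 2) / inv_weight_sum ends w x
                       + (real (deg ends y) - 2) / inv_weight_sum ends w y)"
proof -
  have xy: "x \<noteq> y" using ends_pair_neq[OF e] .
  have adj: "adj ends x y" using e unfolding adj_def by (rule exI)
  then have adj': "adj ends y x" by (simp only: adj_commute)
  have we: "edge_betw ends x y = e" "edge_betw ends y x = e"
    using edge_betw_eq[OF e] edge_betw_commute[of x y] by simp_all
  txt \<open>The potential decreases towards \<open>y\<close> along all edges at \<open>x\<close> and away from \<open>x\<close> along all edges at \<open>y\<close>.\<close>
  define \<sigma> :: "'v \<Rightarrow> 'v \<Rightarrow> real" where "\<sigma> u v =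
    (if u = x \<and> v = y \<or> u = y \<and> v = x then of_bool (v = x) - of_bool (u = x)
     else of_bool (u = x) - of_bool (v = x) + of_bool (v = y) - of_bool (u = y))" for u v
  have anti: "\<sigma> u v = - \<sigma> v u" for u v by (auto simp: \<sigma>_def)
  define \<phi> where "\<phi> u v = \<sigma> u v * w $ edge_betw ends u v" for u v
  have \<phi>_anti: "\<phi> u v = - \<phi> v u" for u v
    unfolding \<phi>_def by (subst anti, subst edge_betw_commute) simp
  then obtain f where f: "\<And>u v. adj ends u v \<Longrightarrow> f v - f u = \<phi> u v"
    using tree_potential[of \<phi>, OF \<phi>_anti] by metis
  have lip: "f u - f v \<le> w $ edge_betw ends u v" if "adj ends u v" for u v
  proof -
    have "f u - f v = - \<sigma> u v * w $ edge_betw ends u v" using f[OF that] by (simp add: \<phi>_def)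
    also have "\<dots> \<le> 1 * w $ edge_betw ends u v"
      using w[of "edge_betw ends u v"] by (intro mult_right_mono) (auto simp: \<sigma>_def)
    finally show ?thesis by simp
  qed
  have fxy: "f x - f y = w $ e" using f[OF adj'] xy by (simp add: \<phi>_def \<sigma>_def we)
  have fx: "f z - f x = (if z = y then - 1 else 1) * w $ edge_betw ends x z" if "adj ends x z" for z
    using f[OF that] that adj_irrefl[of x] xy by (auto simp: \<phi>_def \<sigma>_def)
  have fy: "f z - f y = (if z = x then - (- 1) else - 1) * w $ edge_betw ends y z" if "adj ends y z" for z
    using f[OF that] that adj_irrefl[of y] xy by (auto simp: \<phi>_def \<sigma>_def)
  txt \<open>The mass around \<open>x\<close> is sent to \<open>y\<close>, the mass around \<open>y\<close> comes from \<open>x\<close>, and the remaining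
    mass \<open>\<alpha> - (1 - \<alpha>)\<close> is moved along \<open>e\<close>.\<close>
  define \<pi> where "\<pi> u v = (1 - \<alpha>) * nbr_mass ends w x u * of_bool (v = y)
    + (1 - \<alpha>) * nbr_mass ends w y v * of_bool (u = x) + of_bool (u = x) * of_bool (v = y) * (2 * \<alpha> - 1)" for u v
  have "(\<Sum>v\<in>UNIV. \<pi> u v) = lazy_measure ends w \<alpha> x u" for u
  proof -
    have "(\<Sum>v\<in>UNIV. \<pi> u v) = (1 - \<alpha>) * nbr_mass ends w x u
        + (1 - \<alpha>) * of_bool (u = x) * (\<Sum>v\<in>UNIV. nbr_mass ends w y v) + of_bool (u = x) * (2 * \<alpha> - 1)"
      by (simp add: \<pi>_def sum.distrib sum_distrib_left sum_distrib_right[symmetric] mult.assoc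
          of_bool_def if_distrib[of "(*) _"] cong: if_cong)
    then show ?thesis unfolding sum_nbr_mass_1[OF w adj']
      by (simp add: lazy_measure_eq algebra_simps)
  qed
  moreover have "(\<Sum>u\<in>UNIV. \<pi> u v) = lazy_measure ends w \<alpha> y v" for v
  proof -
    have "(\<Sum>u\<in>UNIV. \<pi> u v) = (1 - \<alpha>) * nbr_mass ends w y v
        + (1 - \<alpha>) * of_bool (v = y) * (\<Sum>u\<in>UNIV. nbr_mass ends w x u) + of_bool (v = y) * (2 * \<alpha> - 1)"
      by (simp add: \<pi>_def sum.distrib sum_distrib_left sum_distrib_right[symmetric] mult.assoc
          of_bool_def if_distrib[of "(*) _"] cong: if_cong)
    then show ?thesis unfolding sum_nbr_mass_1[OF w adj]
      by (simp add: lazy_measure_eq algebra_simps)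
  qed
  moreover have "0 \<le> \<pi> u v" for u v
    unfolding \<pi>_def using \<alpha> nbr_mass_nonneg[OF w] by (intro add_nonneg_nonneg mult_nonneg_nonneg) auto
  ultimately have \<pi>: "\<pi> \<in> couplings (lazy_measure ends w \<alpha> x) (lazy_measure ends w \<alpha> y)"
    by (auto simp: couplings_def)
  have opt: "path_dist ends w u v \<le> f u - f v" if "\<pi> u v \<noteq> 0" for u v
  proof -
    consider "adj ends x u" "v = y" | "u = x" "adj ends y v" | "u = x" "v = y"
      using \<open>\<pi> u v \<noteq> 0\<close> by (cases "v = y"; cases "u = x"; auto simp: \<pi>_def nbr_mass_def split: if_splits)
    then show ?thesis
    proof cases
      case 1
      \<comment> \<open>\<open>y\<close> is itself a neighbour of \<open>x\<close>; the mass there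
        stays in place, at cost 0.\<close>
      show ?thesis
      proof (cases "u = y")
        case False
        then show ?thesis using path_dist_two_edges_le[OF w, of u x y] 1 adj fx[of u] fxy
          by (simp add: adj_commute we edge_betw_commute[of u x])
      qed (use path_dist_refl_le[OF w] 1 in simp)
    next
      case 2
      show ?thesis
      proof (cases "v = x")
        case False
        then show ?thesis using path_dist_two_edges_le[OF w, of x y v] 2 adj fy[of v] fxy
          by (simp add: we)
      qed (use path_dist_refl_le[OF w] 2 in simp)
    next
      case 3
      then show ?thesis using path_dist_edge_le[OF w adj] fxy we by simp
    qed
  qed
  have "wasserstein1 ends w (lazy_measure ends w \<alpha> x) (lazy_measure ends w \<alpha> y) =
      (\<Sum>z\<in>UNIV. f z * lazy_measure ends w \<alpha> x z) - (\<Sum>z\<in>UNIV. f z * lazy_measure ends w \<alpha> y z)"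
    by (rule wasserstein1_eq_potential[where f = f, OF _ \<pi>], erule lip, erule opt)
  also have "(\<Sum>z\<in>UNIV. f z * lazy_measure ends w \<alpha> x z)
      = f x + (1 - \<alpha>) * ((real (deg ends x) - 2) / inv_weight_sum ends w x)"
    using lazy_measure_drift[of w x y f 1 \<alpha>, OF w adj fx] by simp
  also have "(\<Sum>z\<in>UNIV. f z * lazy_measure ends w \<alpha> y z)
      = f y - (1 - \<alpha>) * ((real (deg ends y) - 2) / inv_weight_sum ends w y)"
  proof -
    have "(\<Sum>z\<in>UNIV. f z * lazy_measure ends w \<alpha> y z)
        = f y + (1 - \<alpha>) * ((- 1) * (real (deg ends y) - 2) / inv_weight_sum ends w y)"
      by (rule lazy_measure_drift[OF w adj']) (erule fy)
    then show ?thesis by (simp only: mult_minus1 minus_divide_left[symmetric] mult_minus_right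
          add_uminus_conv_diff)
  qed
  finally show ?thesis using fxy by (simp add: distrib_left del: times_divide_eq_right)
qed

text \<open>As the distance is affine in \<open>1 - \<alpha>\<close>, the difference quotient is
  constant on the interval from \<open>1/2\<close> to 1. Uniqueness of limits then settles the
  definite description, since every edge has some pair of ends.\<close>

theorem curvature_eq_curvature_on:
  assumes w: "\<And>e. 0 < w $ e"
  shows "curvature ends w e = curvature_on ends UNIV w e"
proof -
  let ?q = "\<lambda>x y \<alpha>. (1 - wasserstein1 ends w (lazy_measure ends w \<alpha> x) (lazy_measure ends w \<alpha> y) / w $ e)
              / (1 - \<alpha>)"
  have lim: "(?q x y \<longlongrightarrow> curvature_on ends UNIV w e) (at_left 1)" if e: "ends e = {x, y}" for x y
  proof -
    have "eventually (\<lambda>\<alpha>::real. \<alpha> \<in> {1/2<..<1}) (at_left 1)"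
      by (rule eventually_at_leftI[of "1/2"]) auto
    moreover have "?q x y \<alpha> = curvature_on ends UNIV w e" if "\<alpha> \<in> {1/2<..<1}" for \<alpha>
    proof -
      define A where "A = (real (deg ends x) - 2) / inv_weight_sum ends w x"
      define B where "B = (real (deg ends y) - 2) / inv_weight_sum ends w y"
      have "curvature_on ends UNIV w e = (\<Sum>x\<in>ends e. (2 - real (deg ends x)) / inv_weight_sum ends w x / w $ e)"
        by (simp add: curvature_on_def inv_weight_sum_def inverse_eq_divide mult.commute)
      also have "\<dots> = - A / w $ e - B / w $ e"
        using ends_pair_neq[OF e] by (simp add: e A_def B_def diff_divide_distrib)
      also have "\<dots> = (1 - (w $ e + (1 - \<alpha>) * (A + B)) / w $ e) / (1 - \<alpha>)"
        using that w[of e] by (simp add: field_simps)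
      also have "\<dots> = ?q x y \<alpha>"
        using that wasserstein1_lazy_measure[OF w e, of \<alpha>] by (simp add: A_def B_def)
      finally show ?thesis by simp
    qed
    ultimately have "eventually (\<lambda>\<alpha>. ?q x y \<alpha> = curvature_on ends UNIV w e) (at_left 1)"
      by (rule eventually_mono)
    then show ?thesis by (rule tendsto_eventually)
  qed
  show ?thesis unfolding curvature_def
  proof (rule the_equality)
    show "\<forall>x y. ends e = {x, y} \<longrightarrow> (?q x y \<longlongrightarrow> curvature_on ends UNIV w e) (at_left 1)"
      using lim by blast
  next
    fix k assume k: "\<forall>x y. ends e = {x, y} \<longrightarrow> (?q x y \<longlongrightarrow> k) (at_left 1)"
    obtain x y where e: "ends e = {x, y}" by (rule ends_pairE)
    show "k = curvature_on ends UNIV w e"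
      using tendsto_unique[OF _ k[rule_format, OF e] lim[OF e]] by simp
  qed
qed

end

section \<open>Components\<close>

lemma gwalk_betw_imp_rtranclp:
  "gwalk_betw A R x p y \<Longrightarrow> R\<^sup>*\<^sup>* x y"
proof (induction p arbitrary: x)
  case Nil
  then show ?case by (simp add: gwalk_betw_def gwalk_def)
next
  case (Cons z p)
  show ?case
  proof (cases "p = []")
    case True
    then show ?thesis using Cons.prems by (auto simp: gwalk_betw_def)
  next
    case False
    then have "gwalk_betw A R (hd p) p y" "R x (hd p)"
      using Cons.prems by (auto simp: gwalk_betw_def gwalk_def successively_Cons)
    then show ?thesis using Cons.IH by (meson converse_rtranclp_into_rtranclp)
  qed
qed

text \<open>A relation that stays inside \<open>A\<close> satisfies the vertex condition of walks
  automatically, so components can be treated through the reflexive transitive closure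
  alone.\<close>

lemma ex_gwalk_betw_iff_rtranclp:
  assumes R: "\<And>x y. R x y \<Longrightarrow> y \<in> A" and x: "x \<in> A"
  shows "(\<exists>p. gwalk_betw A R x p y) \<longleftrightarrow> R\<^sup>*\<^sup>* x y"
proof
  assume "R\<^sup>*\<^sup>* x y"
  then show "\<exists>p. gwalk_betw A R x p y"
  proof (induction rule: rtranclp_induct)
    case base
    show ?case using x by (intro exI[of _ "[x]"]) (simp add: gwalk_betw_def gwalk_def)
  next
    case (step y z)
    then obtain p where "gwalk_betw A R x p y" by blast
    then have "gwalk_betw A R x (p @ [z]) z" using step.hyps(2) R
      by (auto simp: gwalk_betw_def gwalk_def successively_append_iff)
    then show ?case by blast
  qed
qed (blast intro: gwalk_betw_imp_rtranclp)

context
  fixes A :: "'a set" and R :: "'a \<Rightarrow> 'a \<Rightarrow> bool"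
  assumes sym: "symp R" and R: "\<forall>x y. R x y \<longrightarrow> y \<in> A"
begin

lemma rtranclp_sym: "R\<^sup>*\<^sup>* x y \<Longrightarrow> R\<^sup>*\<^sup>* y x"
  using sym by (metis sympD symp_rtranclp)

lemma rtranclp_closed: "R\<^sup>*\<^sup>* x y \<Longrightarrow> x \<in> A \<Longrightarrow> y \<in> A"
  by (induction rule: rtranclp_induct) (use R in auto)

lemma gcomponents_eq: "gcomponents A R = (\<lambda>x. {y. R\<^sup>*\<^sup>* x y}) ` A"
proof -
  have "{y \<in> A. \<exists>p. gwalk_betw A R x p y} = {y. R\<^sup>*\<^sup>* x y}" if "x \<in> A" for x
    using ex_gwalk_betw_iff_rtranclp[of R A x] R that rtranclp_closed by blast
  then show ?thesis by (auto simp: gcomponents_def)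
qed

lemma Union_gcomponents: "\<Union>(gcomponents A R) = A"
  unfolding gcomponents_eq using rtranclp_closed by auto

lemma gcomponents_nonempty: "D \<in> gcomponents A R \<Longrightarrow> D \<noteq> {}"
  unfolding gcomponents_eq by auto

lemma gcomponents_disjoint:
  assumes "D \<in> gcomponents A R" "D' \<in> gcomponents A R" "D \<noteq> D'"
  shows "D \<inter> D' = {}"
proof (rule ccontr)
  assume "D \<inter> D' \<noteq> {}"
  moreover obtain x y where "D = {z. R\<^sup>*\<^sup>* x z}" "D' = {z. R\<^sup>*\<^sup>* y z}"
    using assms unfolding gcomponents_eq by blast
  ultimately obtain z where "R\<^sup>*\<^sup>* x z" "R\<^sup>*\<^sup>* y z" and D: "D = {z. R\<^sup>*\<^sup>* x z}" "D' = {z. R\<^sup>*\<^sup>* y z}"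
    by blast
  then have "R\<^sup>*\<^sup>* x y" "R\<^sup>*\<^sup>* y x" using rtranclp_sym by (meson rtranclp_trans)+
  then have "D = D'" unfolding D by (auto intro: rtranclp_trans)
  then show False using assms by simp
qed

lemma gcomponents_step: "D \<in> gcomponents A R \<Longrightarrow> x \<in> D \<Longrightarrow> R x y \<Longrightarrow> y \<in> D"
  unfolding gcomponents_eq by (auto intro: rtranclp.rtrancl_into_rtrancl)

lemma gcomponents_rtranclp: "D \<in> gcomponents A R \<Longrightarrow> x \<in> D \<Longrightarrow> y \<in> D \<Longrightarrow> R\<^sup>*\<^sup>* x y"
  unfolding gcomponents_eq using rtranclp_sym by (auto intro: rtranclp_trans)

lemma gconnected_imp_gcomponents:
  assumes "gconnected A R"
  shows "gcomponents A R = {A}"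
proof -
  have "R\<^sup>*\<^sup>* x y" if "x \<in> A" "y \<in> A" for x y
    using assms that gwalk_betw_imp_rtranclp unfolding gconnected_def by metis
  then have "R\<^sup>*\<^sup>* x y \<longleftrightarrow> y \<in> A" if "x \<in> A" for x y
    using that rtranclp_closed[of x y] by blast
  then have "{y. R\<^sup>*\<^sup>* x y} = A" if "x \<in> A" for x
    using that by simp
  then have "gcomponents A R = (\<lambda>x. A) ` A"
    unfolding gcomponents_eq by (intro image_cong) simp_all
  then show ?thesis using assms by (auto simp: gconnected_def)
qed

end

section \<open>Metrics of constant curvature\<close>

lemma symp_GC_adj: "symp (GC_adj ends C)"
  by (auto simp: GC_adj_def symp_def)

lemma GC_adj_in: "\<forall>e f. GC_adj ends C e f \<longrightarrow> f \<in> C"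
  by (simp add: GC_adj_def)

lemmas Union_GC_components = Union_gcomponents[OF symp_GC_adj GC_adj_in]
  and GC_components_nonempty = gcomponents_nonempty[OF symp_GC_adj GC_adj_in]
  and GC_components_step = gcomponents_step[OF symp_GC_adj GC_adj_in]
  and GC_components_rtranclp = gcomponents_rtranclp[OF symp_GC_adj GC_adj_in]
  and GC_components_disjoint = gcomponents_disjoint[OF symp_GC_adj GC_adj_in]
  and gconnected_GC_components = gconnected_imp_gcomponents[OF symp_GC_adj GC_adj_in]

lemma GC_component_subset: "D \<in> gcomponents C (GC_adj ends C) \<Longrightarrow> D \<subseteq> C"
  using Union_GC_components[of C ends] by blast

text \<open>Two distinct edges at \<open>x\<close> give degree at least 2, hence at least 3, and are
  then adjacent in the graph on \<open>C\<close>. Degree 2 is excluded because two edges may meet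
  there without being adjacent; the coefficient \<open>2 - deg\<close> vanishes at such a
  vertex.\<close>

lemma edges_at_subset_component:
  fixes ends :: "'e::finite \<Rightarrow> 'v set"
  assumes D: "D \<in> gcomponents C (GC_adj ends C)" and e: "e \<in> D" "x \<in> ends e"
    and x: "edges_at ends x \<subseteq> C" "deg ends x \<noteq> 2"
  shows "edges_at ends x \<subseteq> D"
proof
  fix f assume f: "f \<in> edges_at ends x"
  have C: "e \<in> C" using GC_component_subset[OF D] e(1) by blast
  show "f \<in> D"
  proof (cases "f = e")
    case False
    have "card {e, f} \<le> deg ends x" unfolding deg_def
      using e(2) f by (intro card_mono) (simp_all add: edges_at_def)
    then have "deg ends x \<ge> 3" using False x by simp
    then have "GC_adj ends C e f" using False C f e x by (auto simp: GC_adj_def edges_at_def)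
    then show ?thesis using GC_components_step[OF D] e by blast
  qed (use e in simp)
qed

text \<open>The contribution of a vertex is homogeneous of degree 0 in the weights at it, and unless
  its coefficient is 0 these weights all belong to one component.\<close>

lemma curvature_on_cong_scale:
  fixes ends :: "'e::finite \<Rightarrow> 'v::finite set"
  assumes D: "D \<in> gcomponents C (GC_adj ends C)" and e: "e \<in> D"
    and scale: "\<And>f. f \<in> D \<Longrightarrow> p $ f = a * q $ f" and a: "a \<noteq> 0"
  shows "curvature_on ends C p e = curvature_on ends C q e"
  unfolding curvature_on_def
proof (rule sum.cong[OF refl])
  fix x assume "x \<in> {x \<in> ends e. edges_at ends x \<subseteq> C}"
  then have x: "x \<in> ends e" "edges_at ends x \<subseteq> C" by auto
  show "(2 - real (deg ends x)) / (p $ e * (\<Sum>f\<in>edges_at ends x. inverse (p $ f))) =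
      (2 - real (deg ends x)) / (q $ e * (\<Sum>f\<in>edges_at ends x. inverse (q $ f)))"
  proof (cases "deg ends x = 2")
    case False
    then have sub: "edges_at ends x \<subseteq> D" using edges_at_subset_component[OF D e x(1,2)] by blast
    have "(\<Sum>f\<in>edges_at ends x. inverse (p $ f)) = (\<Sum>f\<in>edges_at ends x. inverse a * inverse (q $ f))"
      using sub scale by (intro sum.cong) auto
    then show ?thesis using scale[OF e] a by (simp add: sum_distrib_left[symmetric])
  qed simp
qed

text \<open>A maximum principle: where \<open>p / q\<close> is maximal on a component, all contributions to the
  curvature are at most those of \<open>q\<close>, with equality only if \<open>p / q\<close> is constant nearby.\<close>

lemma const_curv_ratio_step:
  fixes ends :: "'e::finite \<Rightarrow> 'v::finite set"
  assumes D: "D \<in> gcomponents C (GC_adj ends C)" and e: "e \<in> D"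
    and pos: "\<And>f. f \<in> C \<Longrightarrow> 0 < p $ f" "\<And>f. f \<in> C \<Longrightarrow> 0 < q $ f"
    and curv: "curvature_on ends C p e = curvature_on ends C q e"
    and max: "\<And>f. f \<in> D \<Longrightarrow> p $ f / q $ f \<le> p $ e / q $ e"
    and f: "GC_adj ends C e f"
  shows "p $ f / q $ f = p $ e / q $ e"
proof (rule ccontr)
  assume neq: "p $ f / q $ f \<noteq> p $ e / q $ e"
  define P where "P x = p $ e * (\<Sum>f\<in>edges_at ends x. inverse (p $ f))" for x
  define Q where "Q x = q $ e * (\<Sum>f\<in>edges_at ends x. inverse (q $ f))" for x
  have DC: "D \<subseteq> C" using GC_component_subset[OF D] .
  have eC: "e \<in> C" using e DC by blast
  have P: "P x = (\<Sum>f\<in>edges_at ends x. p $ e / p $ f)" for x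
    by (simp add: P_def sum_distrib_left divide_inverse)
  have Q: "Q x = (\<Sum>f\<in>edges_at ends x. q $ e / q $ f)" for x
    by (simp add: Q_def sum_distrib_left divide_inverse)
  have le_iff: "q $ e / q $ g \<le> p $ e / p $ g \<longleftrightarrow> p $ g / q $ g \<le> p $ e / q $ e" if "g \<in> C" for g
    using pos[OF that] pos[OF eC] by (simp add: field_simps)
  have less_iff: "q $ e / q $ g < p $ e / p $ g \<longleftrightarrow> p $ g / q $ g < p $ e / q $ e" if "g \<in> C" for g
    using pos[OF that] pos[OF eC] by (simp add: field_simps)
  have Qpos: "0 < Q x" if "x \<in> ends e" "edges_at ends x \<subseteq> C" for x
    unfolding Q using that pos(2) eC
    by (intro sum_pos) (auto simp: edges_at_def intro!: divide_pos_pos)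
  have QP: "Q x \<le> P x" if "x \<in> ends e" "edges_at ends x \<subseteq> C" "deg ends x \<noteq> 2" for x
    unfolding P Q
  proof (rule sum_mono)
    fix g assume "g \<in> edges_at ends x"
    then have "g \<in> D" using edges_at_subset_component[OF D e that] by blast
    then show "q $ e / q $ g \<le> p $ e / p $ g" using le_iff[of g] max DC by blast
  qed
  \<comment> \<open>A leaf has a positive coefficient, for which a strict inequality between
    \<open>Q\<close> and \<open>P\<close> would push the curvature the wrong way; but there both
    sums equal 1.\<close>
  have deg1: "P x = Q x" if "x \<in> ends e" "edges_at ends x \<subseteq> C" "deg ends x < 2" for x
  proof -
    have ex: "e \<in> edges_at ends x" using that by (auto simp: edges_at_def)
    have "card (edges_at ends x) > 0" using ex by (auto simp: card_gt_0_iff)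
    then have "card (edges_at ends x) = 1" using that(3) by (simp add: deg_def)
    then have "edges_at ends x = {e}" using ex by (auto simp: card_1_singleton_iff)
    then show ?thesis using pos[OF eC] by (simp add: P Q)
  qed
  let ?N = "{x \<in> ends e. edges_at ends x \<subseteq> C}"
  have le: "(2 - real (deg ends x)) / Q x \<le> (2 - real (deg ends x)) / P x" if x: "x \<in> ?N" for x
  proof (cases "deg ends x \<le> 2")
    case True
    then show ?thesis using deg1[of x] x by (cases "deg ends x = 2") auto
  next
    case False
    then have "Q x \<le> P x" "0 < Q x" using QP[of x] Qpos[of x] x by auto
    moreover have "2 - real (deg ends x) \<le> 0" using False by simp
    ultimately show ?thesis by (intro divide_left_mono_neg) auto
  qed
  obtain x where x: "x \<in> ends e" "x \<in> ends f" "3 \<le> deg ends x" "edges_at ends x \<subseteq> C"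
    using f by (auto simp: GC_adj_def)
  have fD: "f \<in> D" using GC_components_step[OF D e f] .
  \<comment> \<open>Where \<open>e\<close> and \<open>f\<close> meet, the coefficient is negative
    and the summand of \<open>f\<close> is strict. This one vertex makes the curvature of
    \<open>p\<close> at \<open>e\<close> exceed that of \<open>q\<close>.\<close>
  have "Q x < P x" unfolding P Q
  proof (rule sum_strict_mono_ex1)
    show "\<forall>g\<in>edges_at ends x. q $ e / q $ g \<le> p $ e / p $ g"
      using edges_at_subset_component[OF D e x(1,4)] x(3) le_iff max DC
      by (metis One_nat_def Suc_1 Suc_n_not_le_n numeral_3_eq_3 subset_iff)
    have "p $ f / q $ f < p $ e / q $ e" using max[OF fD] neq by simp
    then show "\<exists>g\<in>edges_at ends x. q $ e / q $ g < p $ e / p $ g"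
      using less_iff[of f] fD DC x(2) by (intro bexI[of _ f]) (auto simp: edges_at_def)
  qed simp
  then have "(2 - real (deg ends x)) / Q x < (2 - real (deg ends x)) / P x"
    using Qpos[of x] x by (intro divide_strict_left_mono_neg) auto
  then have "(\<Sum>x\<in>?N. (2 - real (deg ends x)) / Q x) < (\<Sum>x\<in>?N. (2 - real (deg ends x)) / P x)"
    using le x by (intro sum_strict_mono_ex1) auto
  then show False using curv unfolding curvature_on_def P_def Q_def by simp
qed

text \<open>The edges of \<open>D\<close> where \<open>p / q\<close> is maximal are closed under
  adjacency, so a walk from one of them carries the maximal value to all of
  \<open>D\<close>.\<close>

lemma const_curv_ratio:
  fixes ends :: "'e::finite \<Rightarrow> 'v::finite set"
  assumes D: "D \<in> gcomponents C (GC_adj ends C)"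
    and p: "p \<in> const_curv_set ends C c" and q: "q \<in> const_curv_set ends C c"
  obtains a where "0 < a" "\<And>e. e \<in> D \<Longrightarrow> p $ e = a * q $ e"
proof -
  have pos: "\<And>f. f \<in> C \<Longrightarrow> 0 < p $ f" "\<And>f. f \<in> C \<Longrightarrow> 0 < q $ f"
    and curv: "\<And>e. e \<in> C \<Longrightarrow> curvature_on ends C p e = curvature_on ends C q e"
    using p q by (auto simp: const_curv_set_def simplex_on_def)
  have DC: "D \<subseteq> C" using GC_component_subset[OF D] .
  define r where "r f = p $ f / q $ f" for f
  have "Max (r ` D) \<in> r ` D" using GC_components_nonempty[OF D] by (intro Max_in) auto
  then obtain e where e: "e \<in> D" "r e = Max (r ` D)" by auto
  have max: "r f \<le> r e" if "f \<in> D" for f using that e by simp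
  have "f \<in> D \<and> r f = r e" if "(GC_adj ends C)\<^sup>*\<^sup>* e f" for f
    using that
  proof (induction rule: rtranclp_induct)
    case (step f g)
    then have "r g = r f"
      unfolding r_def
      by (intro const_curv_ratio_step[OF D _ pos curv, where e = f])
        (use DC max in \<open>auto simp: r_def\<close>)
    then show ?case using step GC_components_step[OF D, of f g] by auto
  qed (use e in simp)
  then have const: "r f = r e" if "f \<in> D" for f
    using GC_components_rtranclp[OF D e(1) that] by blast
  have "p $ f = r e * q $ f" if "f \<in> D" for f
  proof -
    have "q $ f \<noteq> 0" using pos(2)[of f] DC that by auto
    then show ?thesis using const[OF that] by (simp add: r_def divide_eq_eq)
  qed
  moreover have "0 < r e" using pos[of e] e(1) DC unfolding r_def by (auto intro: divide_pos_pos)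
  ultimately show ?thesis using that by blast
qed

text \<open>An edge has two ends, so some vertex differs from \<open>x\<close>, and a walk to it has
  a first edge. This keeps all sums over the edges at a vertex positive, including those under a
  logarithm.\<close>

lemma finite_tree_edges_at_nonempty:
  fixes ends :: "'e::finite \<Rightarrow> 'v::finite set"
  assumes tree: "finite_tree ends"
  shows "edges_at ends x \<noteq> {}"
proof -
  obtain a b where "ends (undefined :: 'e) = {a, b}" "a \<noteq> b" using ends_pairE[OF tree] by blast
  then obtain y where "y \<noteq> x" by metis
  obtain p where "gwalk_betw UNIV (adj ends) x p y"
    using tree unfolding finite_tree_def gconnected_def by blast
  then have "(adj ends)\<^sup>*\<^sup>* x y" by (rule gwalk_betw_imp_rtranclp)
  then obtain z where "adj ends x z" using \<open>y \<noteq> x\<close> by (metis converse_rtranclpE)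
  then show ?thesis by (auto simp: adj_def edges_at_def)
qed

text \<open>A discrete Gauss--Bonnet identity: after exchanging the sums, the shares of the edges at
  a vertex add up to 1, whatever the metric. It determines the constant \<open>c\<close> and makes
  the total of the curvatures constant along the flow.\<close>

lemma sum_curvature_on:
  fixes ends :: "'e::finite \<Rightarrow> 'v::finite set"
  assumes tree: "finite_tree ends" and pos: "\<And>e. e \<in> C \<Longrightarrow> 0 < p $ e"
  shows "(\<Sum>e\<in>C. curvature_on ends C p e) = (\<Sum>x | edges_at ends x \<subseteq> C. 2 - real (deg ends x))"
proof -
  let ?t = "\<lambda>e x. (2 - real (deg ends x)) / (p $ e * (\<Sum>f\<in>edges_at ends x. inverse (p $ f)))"
  have "(\<Sum>e\<in>C. curvature_on ends C p e)
      = (\<Sum>e\<in>C. \<Sum>x\<in>{x. x \<in> {x. edges_at ends x \<subseteq> C} \<and> x \<in> ends e}. ?t e x)"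
    unfolding curvature_on_def by (intro sum.cong) auto
  also have "\<dots> = (\<Sum>x | edges_at ends x \<subseteq> C. \<Sum>e\<in>{e. e \<in> C \<and> x \<in> ends e}. ?t e x)"
    by (rule sum.swap_restrict) auto
  also have "\<dots> = (\<Sum>x | edges_at ends x \<subseteq> C. 2 - real (deg ends x))"
  proof (rule sum.cong[OF refl])
    fix x assume "x \<in> {x. edges_at ends x \<subseteq> C}"
    then have x: "edges_at ends x \<subseteq> C" by simp
    define S where "S = (\<Sum>f\<in>edges_at ends x. inverse (p $ f))"
    have "0 < S" unfolding S_def
      using x pos finite_tree_edges_at_nonempty[OF tree, of x] by (intro sum_pos) auto
    have "{e. e \<in> C \<and> x \<in> ends e} = edges_at ends x" using x by (auto simp: edges_at_def)
    then have "(\<Sum>e\<in>{e. e \<in> C \<and> x \<in> ends e}. ?t e x)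
        = (\<Sum>e\<in>edges_at ends x. (2 - real (deg ends x)) / S * inverse (p $ e))"
      by (simp add: S_def divide_inverse mult_ac)
    also have "\<dots> = (2 - real (deg ends x)) / S * S" by (simp add: S_def sum_distrib_left)
    finally show "(\<Sum>e\<in>{e. e \<in> C \<and> x \<in> ends e}. ?t e x) = 2 - real (deg ends x)"
      using \<open>0 < S\<close> by simp
  qed
  finally show ?thesis .
qed

lemma const_curv_value:
  fixes ends :: "'e::finite \<Rightarrow> 'v::finite set"
  assumes "finite_tree ends" "p \<in> const_curv_set ends C c"
  shows "real (card C) * c = (\<Sum>x | edges_at ends x \<subseteq> C. 2 - real (deg ends x))"
  using sum_curvature_on[OF assms(1), of C p] assms(2)
  by (simp add: const_curv_set_def simplex_on_def)

text \<open>The vectors \<open>q i\<close> are the normalized restrictions of an arbitrary element to the components.\<close>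

lemma const_curv_set_decomposition:
  fixes ends :: "'e::finite \<Rightarrow> 'v::finite set"
  assumes D: "bij_betw D I (gcomponents C (GC_adj ends C))" and I: "finite I"
    and p0: "p0 \<in> const_curv_set ends C c"
  obtains q where "q \<in> (\<Pi>\<^sub>E i\<in>I. simplex_on (D i))"
    "const_curv_set ends C c =
      {(\<Sum>i\<in>I. \<theta> i *\<^sub>R q i) | \<theta>. (\<forall>i\<in>I. 0 < \<theta> i) \<and> (\<Sum>i\<in>I. \<theta> i) = 1}"
proof -
  have comp: "D i \<in> gcomponents C (GC_adj ends C)" if "i \<in> I" for i
    using D that by (auto simp: bij_betw_def)
  have disj: "D i \<inter> D j = {}" if "i \<in> I" "j \<in> I" "i \<noteq> j" for i j
    using GC_components_disjoint[OF comp comp] D that by (metis bij_betw_def inj_onD)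
  have UN: "(\<Union>i\<in>I. D i) = C"
    using Union_GC_components[of C ends] D by (simp add: bij_betw_def)
  have sumC: "(\<Sum>e\<in>C. g e) = (\<Sum>i\<in>I. \<Sum>e\<in>D i. g e)" for g :: "'e \<Rightarrow> real"
    unfolding UN[symmetric] using disj I by (intro sum.UNION_disjoint) auto
  have pos: "0 < p0 $ e" if "e \<in> C" for e
    using p0 that by (auto simp: const_curv_set_def simplex_on_def)
  define P where "P i = (\<Sum>e\<in>D i. p0 $ e)" for i
  have Ppos: "0 < P i" if "i \<in> I" for i
    unfolding P_def using pos GC_component_subset[OF comp[OF that]] GC_components_nonempty[OF comp[OF that]]
    by (intro sum_pos) auto
  \<comment> \<open>The restricted abstraction makes \<open>q\<close> extensional, as membership in
    the dependent product requires; otherwise values outside \<open>I\<close> would spoil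
    uniqueness.\<close>
  define q where "q = (\<lambda>i\<in>I. \<chi> e. if e \<in> D i then p0 $ e / P i else 0)"
  have q: "q i $ e = (if e \<in> D i then p0 $ e / P i else 0)" if "i \<in> I" for i e
    using that by (simp add: q_def)
  have q_simplex: "q \<in> (\<Pi>\<^sub>E i\<in>I. simplex_on (D i))"
  proof (rule PiE_I)
    fix i assume i: "i \<in> I"
    have "(\<Sum>e\<in>D i. q i $ e) = (\<Sum>e\<in>D i. p0 $ e) / P i"
      using q[OF i] by (simp add: sum_divide_distrib)
    then have "(\<Sum>e\<in>D i. q i $ e) = 1" using Ppos[OF i] by (simp add: P_def)
    moreover have "0 < q i $ e" if "e \<in> D i" for e
      using q[OF i] that pos[of e] GC_component_subset[OF comp[OF i]] Ppos[OF i] by auto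
    ultimately show "q i \<in> simplex_on (D i)" using q[OF i] by (simp add: simplex_on_def)
  qed (simp add: q_def)
  have comb: "(\<Sum>i\<in>I. \<theta> i *\<^sub>R q i) $ e = \<theta> j * (p0 $ e / P j)"
    if "j \<in> I" "e \<in> D j" for \<theta> j e
  proof -
    have "(\<Sum>i\<in>I. \<theta> i *\<^sub>R q i) $ e = (\<Sum>i\<in>I. if i = j then \<theta> j * (p0 $ e / P j) else 0)"
      unfolding sum_component using that disj[of _ j] q by (intro sum.cong) auto
    then show ?thesis using that I by simp
  qed
  have comb0: "(\<Sum>i\<in>I. \<theta> i *\<^sub>R q i) $ e = 0" if "e \<notin> C" for \<theta> e
    unfolding sum_component using that UN q by (intro sum.neutral) auto
  have "const_curv_set ends C c =
      {(\<Sum>i\<in>I. \<theta> i *\<^sub>R q i) | \<theta>. (\<forall>i\<in>I. 0 < \<theta> i) \<and> (\<Sum>i\<in>I. \<theta> i) = 1}" (is "_ = ?S")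
  proof (intro equalityI subsetI)
    fix p assume p: "p \<in> const_curv_set ends C c"
    have "\<exists>a. 0 < a \<and> (\<forall>e\<in>D i. p $ e = a * p0 $ e)" if "i \<in> I" for i
      using const_curv_ratio[OF comp[OF that] p p0] by metis
    then obtain a where a: "\<And>i. i \<in> I \<Longrightarrow> 0 < a i" "\<And>i e. i \<in> I \<Longrightarrow> e \<in> D i \<Longrightarrow> p $ e = a i * p0 $ e"
      by metis
    \<comment> \<open>The mass that \<open>p\<close> puts on \<open>D i\<close>: there
      \<open>p\<close> is \<open>a i\<close> times \<open>p0\<close>, and \<open>p0\<close> has mass
      \<open>P i\<close>.\<close>
    define \<theta> where "\<theta> i = a i * P i" for i
    have "(\<Sum>i\<in>I. \<theta> i) = (\<Sum>e\<in>C. p $ e)"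
      unfolding sumC \<theta>_def P_def sum_distrib_left using a(2) by (intro sum.cong) auto
    also have "\<dots> = 1" using p by (simp add: const_curv_set_def simplex_on_def)
    finally have "(\<Sum>i\<in>I. \<theta> i) = 1" .
    moreover have "\<forall>i\<in>I. 0 < \<theta> i" using a(1) Ppos by (simp add: \<theta>_def)
    moreover have "p = (\<Sum>i\<in>I. \<theta> i *\<^sub>R q i)"
    proof (rule vec_eq_iff[THEN iffD2], rule allI)
      fix e
      show "p $ e = (\<Sum>i\<in>I. \<theta> i *\<^sub>R q i) $ e"
      proof (cases "e \<in> C")
        case True
        then obtain j where j: "j \<in> I" "e \<in> D j" using UN by blast
        then show ?thesis using comb[OF j] a(2)[OF j] Ppos[OF j(1)] by (simp add: \<theta>_def)
      next
        case False
        then have "p $ e = 0" using p by (simp add: const_curv_set_def simplex_on_def)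
        then show ?thesis using comb0[OF False] by simp
      qed
    qed
    ultimately show "p \<in> ?S" by blast
  next
    fix p assume "p \<in> ?S"
    then obtain \<theta> where \<theta>: "\<forall>i\<in>I. 0 < \<theta> i" "(\<Sum>i\<in>I. \<theta> i) = 1" and p: "p = (\<Sum>i\<in>I. \<theta> i *\<^sub>R q i)"
      by blast
    have p_eq: "p $ e = (\<theta> j / P j) * p0 $ e" if "j \<in> I" "e \<in> D j" for j e
      using comb[OF that] p by simp
    have "0 < p $ e \<and> curvature_on ends C p e = c" if "e \<in> C" for e
    proof -
      obtain j where j: "j \<in> I" "e \<in> D j" using \<open>e \<in> C\<close> UN by blast
      have "curvature_on ends C p e = curvature_on ends C p0 e"
        using p_eq[OF j(1)] \<theta>(1) j(1) Ppos[OF j(1)]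
        by (intro curvature_on_cong_scale[OF comp[OF j(1)] j(2), of _ "\<theta> j / P j"]) auto
      moreover have "0 < p $ e"
        using p_eq[OF j] \<theta>(1) j(1) Ppos[OF j(1)] pos[OF that] by simp
      ultimately show ?thesis using p0 that by (simp add: const_curv_set_def)
    qed
    moreover have "(\<Sum>e\<in>C. p $ e) = 1"
    proof -
      have "(\<Sum>e\<in>C. p $ e) = (\<Sum>i\<in>I. \<theta> i / P i * P i)"
        unfolding sumC P_def[of i for i] sum_distrib_left using p_eq
        by (intro sum.cong refl) (simp add: P_def)
      also have "\<dots> = (\<Sum>i\<in>I. \<theta> i)" using Ppos by (intro sum.cong) force+
      finally show ?thesis using \<theta>(2) by simp
    qed
    moreover have "p $ e = 0" if "e \<notin> C" for e using comb0[OF that] p by simp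
    ultimately show "p \<in> const_curv_set ends C c" by (simp add: const_curv_set_def simplex_on_def)
  qed
  then show ?thesis using q_simplex that by blast
qed

section \<open>Simplices spanned by vectors with disjoint supports\<close>

context
  fixes D :: "'i \<Rightarrow> 'e::finite set" and I :: "'i set"
  assumes disj: "\<And>i j. i \<in> I \<Longrightarrow> j \<in> I \<Longrightarrow> i \<noteq> j \<Longrightarrow> D i \<inter> D j = {}"
    and nonempty: "\<And>i. i \<in> I \<Longrightarrow> D i \<noteq> {}" and I: "finite I" "I \<noteq> {}"
begin

lemma simplex_combination_component:
  assumes q: "\<And>i. i \<in> I \<Longrightarrow> q i \<in> simplex_on (D i)" and j: "j \<in> I" "e \<in> D j"
  shows "(\<Sum>i\<in>I. \<theta> i *\<^sub>R q i) $ e = \<theta> j * q j $ e"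
proof -
  have "q i $ e = 0" if "i \<in> I" "i \<noteq> j" for i
    using q[OF that(1)] disj[OF that(1) j(1) that(2)] j by (auto simp: simplex_on_def)
  then have "(\<Sum>i\<in>I. \<theta> i *\<^sub>R q i) $ e = (\<Sum>i\<in>I. if i = j then \<theta> j * q j $ e else 0)"
    unfolding sum_component by (intro sum.cong) auto
  then show ?thesis using j I by simp
qed

text \<open>A single point is enough: the barycentre of the \<open>q' i\<close> is also a positive
  combination of the \<open>q i\<close>. Restricted to \<open>D j\<close> this makes
  \<open>q' j\<close> and \<open>q j\<close> proportional, and both have sum 1.\<close>

lemma simplex_decomposition_unique:
  assumes q: "q \<in> (\<Pi>\<^sub>E i\<in>I. simplex_on (D i))" and q': "q' \<in> (\<Pi>\<^sub>E i\<in>I. simplex_on (D i))"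
    and sub: "{(\<Sum>i\<in>I. \<theta> i *\<^sub>R q' i) | \<theta>. (\<forall>i\<in>I. 0 < \<theta> i) \<and> (\<Sum>i\<in>I. \<theta> i) = 1}
      \<subseteq> {(\<Sum>i\<in>I. \<theta> i *\<^sub>R q i) | \<theta> :: 'i \<Rightarrow> real. (\<forall>i\<in>I. 0 < \<theta> i) \<and> (\<Sum>i\<in>I. \<theta> i) = 1}"
  shows "q' = q"
proof (rule PiE_ext[OF q' q])
  fix j assume j: "j \<in> I"
  have qS: "\<And>i. i \<in> I \<Longrightarrow> q i \<in> simplex_on (D i)" "\<And>i. i \<in> I \<Longrightarrow> q' i \<in> simplex_on (D i)"
    using q q' by auto
  define n where "n = 1 / real (card I)"
  have n: "0 < n" "(\<Sum>i\<in>I. n) = 1" using I by (auto simp: n_def card_gt_0_iff)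
  then have "(\<Sum>i\<in>I. n *\<^sub>R q' i) \<in> {(\<Sum>i\<in>I. \<theta> i *\<^sub>R q' i) | \<theta>. (\<forall>i\<in>I. 0 < \<theta> i) \<and> (\<Sum>i\<in>I. \<theta> i) = 1}"
    by (intro CollectI exI[of _ "\<lambda>_. n"]) simp
  then obtain \<theta> where eq: "(\<Sum>i\<in>I. n *\<^sub>R q' i) = (\<Sum>i\<in>I. \<theta> i *\<^sub>R q i)"
    using sub by blast
  have *: "n * q' j $ e = \<theta> j * q j $ e" if "e \<in> D j" for e
    using simplex_combination_component[of q' j e "\<lambda>_. n"] simplex_combination_component[of q j e \<theta>]
      qS j that eq by simp
  have "(\<Sum>e\<in>D j. n * q' j $ e) = (\<Sum>e\<in>D j. \<theta> j * q j $ e)" using * by (intro sum.cong) auto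
  then have "n * (\<Sum>e\<in>D j. q' j $ e) = \<theta> j * (\<Sum>e\<in>D j. q j $ e)"
    by (simp add: sum_distrib_left)
  then have "n = \<theta> j" using qS[OF j] by (simp add: simplex_on_def)
  then have "q' j $ e = q j $ e" if "e \<in> D j" for e using *[OF that] n by simp
  moreover have "q' j $ e = q j $ e" if "e \<notin> D j" for e using qS[OF j] that by (simp add: simplex_on_def)
  ultimately show "q' j = q j" by (metis vec_eq_iff)
qed

text \<open>Nonzero vectors with disjoint supports are linearly, hence affinely, independent, so
  they are the vertices of a simplex whose relative interior consists of the combinations with
  positive coefficients. Injectivity of \<open>q\<close> transfers sums over \<open>I\<close> to
  sums over the set of vertices.\<close>

lemma simplex_combinations_open_simplex:
  assumes q: "q \<in> (\<Pi>\<^sub>E i\<in>I. simplex_on (D i))"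
  shows "\<exists>S. (int (card I) - 1) simplex S \<and>
    {(\<Sum>i\<in>I. \<theta> i *\<^sub>R q i) | \<theta> :: 'i \<Rightarrow> real. (\<forall>i\<in>I. 0 < \<theta> i) \<and> (\<Sum>i\<in>I. \<theta> i) = 1} = rel_interior S"
proof -
  have qS: "\<And>i. i \<in> I \<Longrightarrow> q i \<in> simplex_on (D i)" using q by auto
  have inj: "inj_on q I"
  proof (rule inj_onI, rule ccontr)
    fix i j assume ij: "i \<in> I" "j \<in> I" "q i = q j" "i \<noteq> j"
    obtain e where "e \<in> D i" using nonempty ij by blast
    then have "0 < q i $ e" "q j $ e = 0"
      using qS[OF ij(1)] qS[OF ij(2)] disj[OF ij(1,2,4)] by (auto simp: simplex_on_def)
    then show False using ij by simp
  qed
  let ?V = "q ` I"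
  have "\<not> affine_dependent ?V"
  proof
    assume "affine_dependent ?V"
    then obtain u v where uv: "v \<in> ?V" "u v \<noteq> 0" "(\<Sum>v\<in>?V. u v *\<^sub>R v) = 0"
      using I by (auto simp: affine_dependent_explicit_finite)
    then obtain j where j: "j \<in> I" "v = q j" by blast
    obtain e where e: "e \<in> D j" using nonempty j by blast
    have "(\<Sum>i\<in>I. u (q i) *\<^sub>R q i) = 0" using uv(3) by (simp add: sum.reindex[OF inj])
    then have "u (q j) * q j $ e = 0"
      using simplex_combination_component[OF qS j(1) e, of "\<lambda>i. u (q i)"] by simp
    then show False using uv(2) j qS[OF j(1)] e by (auto simp: simplex_on_def)
  qed
  moreover have "{(\<Sum>i\<in>I. \<theta> i *\<^sub>R q i) | \<theta> :: 'i \<Rightarrow> real. (\<forall>i\<in>I. 0 < \<theta> i) \<and> (\<Sum>i\<in>I. \<theta> i) = 1}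
      = rel_interior (convex hull ?V)"
  proof -
    have "(\<Sum>i\<in>I. \<theta> i *\<^sub>R q i) \<in> rel_interior (convex hull ?V)"
      if \<theta>: "\<forall>i\<in>I. 0 < \<theta> i" "(\<Sum>i\<in>I. \<theta> i) = 1" for \<theta>
      unfolding rel_interior_convex_hull_explicit[OF \<open>\<not> affine_dependent ?V\<close>]
      using \<theta> inj
      by (intro CollectI exI[of _ "\<lambda>v. \<theta> (inv_into I q v)"]) (simp add: sum.reindex[OF inj])
    moreover have "\<exists>\<theta>. y = (\<Sum>i\<in>I. \<theta> i *\<^sub>R q i) \<and> (\<forall>i\<in>I. 0 < \<theta> i) \<and> (\<Sum>i\<in>I. \<theta> i) = (1::real)"
      if "y \<in> rel_interior (convex hull ?V)" for y
    proof -
      obtain u where "\<forall>x\<in>?V. 0 < u x" "sum u ?V = 1" "(\<Sum>x\<in>?V. u x *\<^sub>R x) = y"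
        using \<open>y \<in> _\<close> unfolding rel_interior_convex_hull_explicit[OF \<open>\<not> affine_dependent ?V\<close>] by blast
      then show ?thesis by (intro exI[of _ "\<lambda>i. u (q i)"]) (simp add: sum.reindex[OF inj])
    qed
    ultimately show ?thesis by blast
  qed
  moreover have "int (card ?V) = int (card I) - 1 + 1" using inj by (simp add: card_image)
  ultimately show ?thesis unfolding simplex_def by blast
qed

end

section \<open>Gradient flows of concave functions\<close>

text \<open>The half-line in the derivative reflects that the flow is differentiable at time 0 only
  from the right.\<close>

lemma nonneg_derivative_imp_le:
  fixes f :: "real \<Rightarrow> real"
  assumes der: "\<And>t. a \<le> t \<Longrightarrow> (f has_real_derivative f' t) (at t within {a..})"
    and nonneg: "\<And>t. a \<le> t \<Longrightarrow> 0 \<le> f' t" and st: "a \<le> s" "s \<le> t"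
  shows "f s \<le> f t"
proof -
  have "(f has_derivative (*) (f' x)) (at x within {s..t})" if "s \<le> x" "x \<le> t" for x
    using der[of x] st that
    by (auto simp: has_field_derivative_def intro: has_derivative_subset)
  then obtain x where "x \<in> {s..t}" "f t - f s = f' x * (t - s)"
    using mvt_very_simple[OF st(2), of f "\<lambda>x. (*) (f' x)"] by auto
  moreover have "0 \<le> f' x * (t - s)" using calculation(1) st nonneg[of x] by simp
  ultimately show ?thesis by simp
qed

lemma vector_derivative_norm_bound:
  fixes z :: "real \<Rightarrow> 'a::euclidean_space"
  assumes der: "\<And>t. a \<le> t \<Longrightarrow> (z has_vector_derivative z' t) (at t within {a..})"
    and bound: "\<And>t. s \<le> t \<Longrightarrow> norm (z' t) \<le> B" and st: "a \<le> s" "s \<le> t"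
  shows "norm (z t - z s) \<le> B * (t - s)"
proof (cases "s = t")
  case False
  have "\<exists>x\<in>{s<..<t}. norm (z t - z s) \<le> norm ((t - s) *\<^sub>R z' x)"
  proof (rule mvt_general)
    show "s < t" using st False by simp
    show "continuous_on {s..t} z"
      unfolding continuous_on_eq_continuous_within
    proof
      fix x assume "x \<in> {s..t}"
      then have "(z has_vector_derivative z' x) (at x within {s..t})"
        using der[of x] st by (auto intro: has_vector_derivative_within_subset)
      then show "continuous (at x within {s..t}) z" by (rule has_vector_derivative_continuous)
    qed
    fix x assume x: "s < x" "x < t"
    have "(z has_vector_derivative z' x) (at x within {s<..<t})"
      using der[of x] st x by (auto intro: has_vector_derivative_within_subset)
    then have "(z has_vector_derivative z' x) (at x)"
      using x at_within_open[of x "{s<..<t}"] by simp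
    then show "(z has_derivative (\<lambda>h. h *\<^sub>R z' x)) (at x)"
      by (simp add: has_vector_derivative_def)
  qed
  then obtain x where x: "s < x" "norm (z t - z s) \<le> (t - s) * norm (z' x)" using st by auto
  note x(2)
  also have "(t - s) * norm (z' x) \<le> (t - s) * B"
    using st bound[of x] x by (intro mult_left_mono) auto
  finally show ?thesis by (simp add: mult.commute)
qed simp

text \<open>Speed is a limit of quotients of displacements. This carries estimates for finite time
  shifts over to the norm of the gradient without differentiating the gradient.\<close>

lemma has_vector_derivative_norm_quotient:
  fixes z :: "real \<Rightarrow> 'a::real_normed_vector"
  assumes "(z has_vector_derivative d) (at t within {a..})" "a \<le> t"
  shows "((\<lambda>h. norm (z (t + h) - z t) / h) \<longlongrightarrow> norm d) (at_right 0)"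
proof -
  have "(z has_derivative (\<lambda>h. h *\<^sub>R d)) (at t within {t<..})"
    using assms by (auto simp: has_vector_derivative_def intro: has_derivative_subset)
  then have "((\<lambda>y. (1 / norm (y - t)) *\<^sub>R (z y - (z t + (y - t) *\<^sub>R d))) \<longlongrightarrow> 0) (at_right t)"
    by (simp add: has_derivative_within)
  then have "((\<lambda>h. (1 / norm h) *\<^sub>R (z (t + h) - (z t + h *\<^sub>R d)) + d) \<longlongrightarrow> 0 + d) (at_right 0)"
    unfolding at_right_to_0[of t] filterlim_filtermap
    by (intro tendsto_intros) (simp add: add.commute)
  then have "((\<lambda>h. norm ((1 / norm h) *\<^sub>R (z (t + h) - (z t + h *\<^sub>R d)) + d)) \<longlongrightarrow> norm d) (at_right 0)"
    by (auto dest: tendsto_norm)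
  moreover have "eventually (\<lambda>h. norm ((1 / norm h) *\<^sub>R (z (t + h) - (z t + h *\<^sub>R d)) + d)
      = norm (z (t + h) - z t) / h) (at_right 0)"
    unfolding eventually_at_right_field
  proof (intro exI[of _ 1] conjI allI impI)
    fix h :: real assume h: "0 < h"
    have "(1 / norm h) *\<^sub>R (z (t + h) - (z t + h *\<^sub>R d)) + d = (1 / h) *\<^sub>R (z (t + h) - z t)"
      using h by (simp add: algebra_simps)
    then show "norm ((1 / norm h) *\<^sub>R (z (t + h) - (z t + h *\<^sub>R d)) + d) = norm (z (t + h) - z t) / h"
      using h by simp
  qed simp
  ultimately show ?thesis by (simp cong: tendsto_cong)
qed

context
  fixes F :: "'a::euclidean_space \<Rightarrow> real" and g :: "'a \<Rightarrow> 'a" and z :: "real \<Rightarrow> 'a"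
  assumes grad: "\<And>u. (F has_derivative (\<lambda>h. g u \<bullet> h)) (at u)"
    and concave: "\<And>u v. F u \<le> F v + g v \<bullet> (u - v)"
    and flow: "\<And>t. 0 \<le> t \<Longrightarrow> (z has_vector_derivative g (z t)) (at t within {0..})"
begin

text \<open>Adding the tangent inequalities at two points shows that
  \<open>(g u - g v) \<bullet> (u - v) \<le> 0\<close>, so two trajectories never move apart. Here
  they are one trajectory and its shift by \<open>h\<close>.\<close>

lemma gradient_flow_contraction:
  assumes h: "0 \<le> h" and st: "0 \<le> s" "s \<le> t"
  shows "norm (z (t + h) - z t) \<le> norm (z (s + h) - z s)"
proof -
  let ?d = "\<lambda>t. z (t + h) - z t"
  have "- (?d s \<bullet> ?d s) \<le> - (?d t \<bullet> ?d t)"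
  proof (rule nonneg_derivative_imp_le[OF _ _ st])
    fix t :: real assume t: "0 \<le> t"
    have "(z has_vector_derivative g (z (t + h))) (at (t + h) within (\<lambda>t. t + h) ` {0..})"
      using flow[of "t + h"] t h by (auto intro: has_vector_derivative_within_subset)
    then have "((z \<circ> (\<lambda>t. t + h)) has_vector_derivative 1 *\<^sub>R g (z (t + h))) (at t within {0..})"
      by (intro vector_diff_chain_within) (auto intro!: derivative_eq_intros)
    then have "(?d has_vector_derivative (g (z (t + h)) - g (z t))) (at t within {0..})"
      using flow[OF t] by (auto simp: o_def intro!: derivative_eq_intros)
    then have "(?d has_derivative (\<lambda>x. x *\<^sub>R (g (z (t + h)) - g (z t)))) (at t within {0..})"
      by (simp add: has_vector_derivative_def)
    then have "((\<lambda>t. - (?d t \<bullet> ?d t)) has_derivative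
        (\<lambda>x. - (?d t \<bullet> (x *\<^sub>R (g (z (t + h)) - g (z t))) + (x *\<^sub>R (g (z (t + h)) - g (z t))) \<bullet> ?d t)))
        (at t within {0..})"
      by (intro has_derivative_minus has_derivative_inner)
    then show "((\<lambda>t. - (?d t \<bullet> ?d t)) has_real_derivative
        - (2 * (?d t \<bullet> (g (z (t + h)) - g (z t))))) (at t within {0..})"
      unfolding has_field_derivative_def
      by (rule has_derivative_eq_rhs) (auto simp: fun_eq_iff inner_commute algebra_simps)
    have "?d t \<bullet> (g (z (t + h)) - g (z t)) \<le> 0"
      using concave[of "z (t + h)" "z t"] concave[of "z t" "z (t + h)"]
      by (simp add: inner_diff inner_commute)
    then show "0 \<le> - (2 * (?d t \<bullet> (g (z (t + h)) - g (z t))))" by simp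
  qed
  then have "norm (?d t) ^ 2 \<le> norm (?d s) ^ 2" by (simp add: power2_norm_eq_inner)
  then show ?thesis by (rule power2_le_imp_le) simp
qed

text \<open>The contraction estimate is divided by \<open>h\<close>, and \<open>h\<close> tends to
  0.\<close>

lemma gradient_flow_norm_antimono:
  assumes st: "0 \<le> s" "s \<le> t"
  shows "norm (g (z t)) \<le> norm (g (z s))"
proof (rule tendsto_le)
  show "((\<lambda>h. norm (z (s + h) - z s) / h) \<longlongrightarrow> norm (g (z s))) (at_right 0)"
    by (rule has_vector_derivative_norm_quotient[OF flow]) (use st in auto)
  show "((\<lambda>h. norm (z (t + h) - z t) / h) \<longlongrightarrow> norm (g (z t))) (at_right 0)"
    by (rule has_vector_derivative_norm_quotient[OF flow]) (use st in auto)
  show "eventually (\<lambda>h. norm (z (t + h) - z t) / h \<le> norm (z (s + h) - z s) / h) (at_right 0)"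
    unfolding eventually_at_right_field
    using gradient_flow_contraction[OF _ st] by (intro exI[of _ 1]) (auto intro!: divide_right_mono)
qed simp

text \<open>Along the flow \<open>F\<close> grows at rate \<open>|g|\<^sup>2\<close>, hence at least
  \<rho> squared, while concavity bounds the total growth by the linear term at the starting
  point.\<close>

lemma gradient_flow_increase:
  assumes \<rho>: "0 \<le> \<rho>" "\<And>t. 0 \<le> t \<Longrightarrow> \<rho> \<le> norm (g (z t))" and st: "0 \<le> s" "s \<le> t"
  shows "\<rho>\<^sup>2 * (t - s) \<le> g (z s) \<bullet> (z t - z s)"
proof -
  have "F (z s) - \<rho>\<^sup>2 * s \<le> F (z t) - \<rho>\<^sup>2 * t"
  proof (rule nonneg_derivative_imp_le[OF _ _ st])
    fix t :: real assume t: "0 \<le> t"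
    have "(z has_derivative (\<lambda>x. x *\<^sub>R g (z t))) (at t within {0..})"
      using flow[OF t] by (simp add: has_vector_derivative_def)
    from has_derivative_compose[OF this grad]
    have "((\<lambda>t. F (z t)) has_derivative (*) (g (z t) \<bullet> g (z t))) (at t within {0..})"
      by (rule has_derivative_eq_rhs) (auto simp: fun_eq_iff)
    then have "((\<lambda>t. F (z t)) has_real_derivative g (z t) \<bullet> g (z t)) (at t within {0..})"
      by (simp add: has_field_derivative_def)
    then show "((\<lambda>t. F (z t) - \<rho>\<^sup>2 * t) has_real_derivative g (z t) \<bullet> g (z t) - \<rho>\<^sup>2) (at t within {0..})"
      by (auto intro!: derivative_eq_intros)
    show "0 \<le> g (z t) \<bullet> g (z t) - \<rho>\<^sup>2"
      using power_mono[OF \<rho>(2)[OF t] \<rho>(1), of 2] by (simp add: power2_norm_eq_inner)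
  qed
  then show ?thesis using concave[of "z t" "z s"] by (simp add: algebra_simps)
qed

text \<open>A cluster point \<open>v\<close> of \<open>z n / n\<close> has norm at most \<open>\<rho> = lim |g|\<close>, and concavity gives
  \<open>g \<bullet> v \<ge> \<rho>\<^sup>2\<close> along the flow; so \<open>|g - v|\<^sup>2 \<le> |g|\<^sup>2 - \<rho>\<^sup>2\<close> tends to \<open>0\<close>.\<close>

theorem gradient_flow_gradient_converges: "\<exists>v. ((\<lambda>t. g (z t)) \<longlongrightarrow> v) at_top"
proof -
  define \<rho> where "\<rho> = Inf ((\<lambda>t. norm (g (z t))) ` {0..})"
  have bdd: "bdd_below ((\<lambda>t. norm (g (z t))) ` {0..})" by (intro bdd_belowI[of _ 0]) auto
  have \<rho>_le: "\<rho> \<le> norm (g (z t))" if "0 \<le> t" for t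
    unfolding \<rho>_def using bdd that by (intro cInf_lower) auto
  have \<rho>_nonneg: "0 \<le> \<rho>" unfolding \<rho>_def by (intro cInf_greatest) auto
  have lip: "norm (z t - z s) \<le> norm (g (z s)) * (t - s)" if "0 \<le> s" "s \<le> t" for s t
    using that gradient_flow_norm_antimono[of s]
    by (intro vector_derivative_norm_bound[OF flow]) auto
  define X where "X n = (1 / real (Suc n)) *\<^sub>R z (real (Suc n))" for n
  have "norm (X n) \<le> norm (z 0) + norm (g (z 0))" for n
  proof -
    have "norm (z (real (Suc n))) \<le> norm (z 0) + norm (z (real (Suc n)) - z 0)"
      by (rule norm_triangle_sub)
    also have "\<dots> \<le> norm (z 0) * real (Suc n) + norm (g (z 0)) * real (Suc n)"
      using lip[of 0 "real (Suc n)"] mult_left_mono[of 1 "real (Suc n)" "norm (z 0)"] by simp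
    finally have "norm (z (real (Suc n))) / real (Suc n) \<le> norm (z 0) + norm (g (z 0))"
      by (simp add: pos_divide_le_eq) (simp add: algebra_simps)
    then show ?thesis by (simp add: X_def)
  qed
  then have "bounded (range X)" by (auto simp: bounded_iff)
  then obtain v r where r: "strict_mono r" and v: "(X \<circ> r) \<longlonglongrightarrow> v"
    using bounded_imp_convergent_subsequence by blast
  have inv: "(\<lambda>n. 1 / real (Suc (r n))) \<longlonglongrightarrow> 0"
    using LIMSEQ_subseq_LIMSEQ[OF LIMSEQ_Suc[OF lim_inverse_n'] r] by (simp add: o_def)
  \<comment> \<open>Subtracting the fixed vector \<open>z s\<close> does not affect the limit, so
    the mean velocity from any starting time \<open>s\<close> also tends to
    \<open>v\<close>.\<close>
  have quot: "(\<lambda>n. (1 / real (Suc (r n))) *\<^sub>R (z (real (Suc (r n))) - z s)) \<longlonglongrightarrow> v" for s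
  proof -
    have "(\<lambda>n. X (r n) - (1 / real (Suc (r n))) *\<^sub>R z s) \<longlonglongrightarrow> v - 0 *\<^sub>R z s"
      using v inv by (intro tendsto_intros) (auto simp: o_def)
    then show ?thesis by (simp add: X_def scaleR_diff_right)
  qed
  \<comment> \<open>The factor \<open>(N - s) / N\<close> that arises when a bound over the times
    from \<open>s\<close> to \<open>N\<close> is divided by \<open>N\<close>.\<close>
  have fac: "(\<lambda>n. a * (1 - s * (1 / real (Suc (r n))))) \<longlonglongrightarrow> a" for a s :: real
    by (rule tendsto_eq_intros inv refl | simp)+
  have large: "eventually (\<lambda>n. s \<le> real (Suc (r n))) sequentially" for s :: real
  proof -
    have "eventually (\<lambda>n. s \<le> real n) sequentially" by (rule eventually_sequentiallyI[of "nat \<lceil>s\<rceil>"]) linarith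
    then show ?thesis
    proof (rule eventually_mono)
      fix n assume "s \<le> real n"
      also have "real n \<le> real (Suc (r n))" using seq_suble[OF r, of n] by simp
      finally show "s \<le> real (Suc (r n))" .
    qed
  qed
  have v_norm: "norm v \<le> norm (g (z s))" if "0 \<le> s" for s
  proof (rule tendsto_le)
    show "(\<lambda>n. norm (g (z s)) * (1 - s * (1 / real (Suc (r n))))) \<longlonglongrightarrow> norm (g (z s))" by (rule fac)
    show "(\<lambda>n. norm ((1 / real (Suc (r n))) *\<^sub>R (z (real (Suc (r n))) - z s))) \<longlonglongrightarrow> norm v"
      by (rule tendsto_norm[OF quot])
    show "eventually (\<lambda>n. norm ((1 / real (Suc (r n))) *\<^sub>R (z (real (Suc (r n))) - z s))
        \<le> norm (g (z s)) * (1 - s * (1 / real (Suc (r n))))) sequentially"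
      using large[of s]
    proof (rule eventually_mono)
      fix n assume "s \<le> real (Suc (r n))"
      moreover define N where "N = real (Suc (r n))"
      ultimately have "norm (z N - z s) \<le> norm (g (z s)) * (N - s)" "0 < N"
        using lip[OF that, of N] by auto
      then have "norm (z N - z s) / N \<le> norm (g (z s)) * (1 - s * (1 / N))"
        by (simp add: pos_divide_le_eq) (simp add: algebra_simps)
      then show "norm ((1 / real (Suc (r n))) *\<^sub>R (z (real (Suc (r n))) - z s))
        \<le> norm (g (z s)) * (1 - s * (1 / real (Suc (r n))))"
        unfolding N_def[symmetric] using \<open>0 < N\<close> by simp
    qed
  qed simp
  have v_inner: "\<rho>\<^sup>2 \<le> g (z s) \<bullet> v" if "0 \<le> s" for s
  proof (rule tendsto_le)
    show "(\<lambda>n. \<rho>\<^sup>2 * (1 - s * (1 / real (Suc (r n))))) \<longlonglongrightarrow> \<rho>\<^sup>2" by (rule fac)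
    show "(\<lambda>n. g (z s) \<bullet> ((1 / real (Suc (r n))) *\<^sub>R (z (real (Suc (r n))) - z s))) \<longlonglongrightarrow> g (z s) \<bullet> v"
      by (intro tendsto_intros quot)
    show "eventually (\<lambda>n. \<rho>\<^sup>2 * (1 - s * (1 / real (Suc (r n))))
        \<le> g (z s) \<bullet> ((1 / real (Suc (r n))) *\<^sub>R (z (real (Suc (r n))) - z s))) sequentially"
      using large[of s]
    proof (rule eventually_mono)
      fix n assume "s \<le> real (Suc (r n))"
      moreover define N where "N = real (Suc (r n))"
      ultimately have "\<rho>\<^sup>2 * (N - s) \<le> g (z s) \<bullet> (z N - z s)" "0 < N"
        using gradient_flow_increase[OF \<rho>_nonneg \<rho>_le that, of N] by auto
      then have "\<rho>\<^sup>2 * (1 - s * (1 / N)) \<le> (g (z s) \<bullet> (z N - z s)) / N"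
        by (simp add: pos_le_divide_eq) (simp add: algebra_simps)
      then show "\<rho>\<^sup>2 * (1 - s * (1 / real (Suc (r n))))
        \<le> g (z s) \<bullet> ((1 / real (Suc (r n))) *\<^sub>R (z (real (Suc (r n))) - z s))"
        unfolding N_def[symmetric] by simp
    qed
  qed simp
  have "norm v \<le> \<rho>" unfolding \<rho>_def using v_norm by (intro cInf_greatest) auto
  then have v2: "v \<bullet> v \<le> \<rho>\<^sup>2"
    using power_mono[of "norm v" \<rho> 2] by (simp add: power2_norm_eq_inner)
  have dist: "norm (g (z t) - v) ^ 2 \<le> norm (g (z t)) ^ 2 - \<rho>\<^sup>2" if "0 \<le> t" for t
    using v_inner[OF that] v2 by (simp add: power2_norm_eq_inner inner_diff inner_commute)
  have "((\<lambda>t. norm (g (z t))) \<longlongrightarrow> \<rho>) at_top"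
  proof (rule order_tendstoI)
    fix a assume "a < \<rho>"
    then show "eventually (\<lambda>t. a < norm (g (z t))) at_top"
      using \<rho>_le by (intro eventually_at_top_linorderI[of 0]) force
  next
    fix a assume "\<rho> < a"
    then obtain s where s: "0 \<le> s" "norm (g (z s)) < a"
      unfolding \<rho>_def using cInf_less_iff[OF _ bdd] by auto
    then show "eventually (\<lambda>t. norm (g (z t)) < a) at_top"
      using gradient_flow_norm_antimono[of s] by (intro eventually_at_top_linorderI[of s]) force
  qed
  then have lim: "((\<lambda>t. norm (g (z t)) ^ 2 - \<rho>\<^sup>2) \<longlongrightarrow> \<rho>\<^sup>2 - \<rho>\<^sup>2) at_top"
    by (intro tendsto_intros)
  have "((\<lambda>t. norm (g (z t) - v) ^ 2) \<longlongrightarrow> 0) at_top"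
  proof (rule tendsto_sandwich[OF _ _ tendsto_const])
    show "((\<lambda>t. norm (g (z t)) ^ 2 - \<rho>\<^sup>2) \<longlongrightarrow> 0) at_top" using lim by simp
    show "eventually (\<lambda>t. norm (g (z t) - v) ^ 2 \<le> norm (g (z t)) ^ 2 - \<rho>\<^sup>2) at_top"
      using dist by (intro eventually_at_top_linorderI[of 0]) auto
  qed simp
  then have "((\<lambda>t. sqrt (norm (g (z t) - v) ^ 2)) \<longlongrightarrow> sqrt 0) at_top"
    by (rule tendsto_real_sqrt)
  then have "((\<lambda>t. g (z t) - v) \<longlongrightarrow> 0) at_top"
    by (simp add: tendsto_norm_zero_iff)
  then show ?thesis by (intro exI) (rule LIM_zero_cancel)
qed

end

section \<open>Convergence of the curvatures\<close>

definition curv_potential :: "('e::finite \<Rightarrow> 'v::finite set) \<Rightarrow> real ^ 'e \<Rightarrow> real" where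
  "curv_potential ends y =
     (\<Sum>x\<in>UNIV. (2 - real (deg ends x)) * ln (\<Sum>f\<in>edges_at ends x. exp (y $ f)))"

text \<open>If \<open>exp (y $ e)\<close> is the inverse weight of \<open>e\<close>, the quotient is
  the probability that the walk at \<open>x\<close> steps across \<open>e\<close>.\<close>

definition curv_gradient :: "('e::finite \<Rightarrow> 'v::finite set) \<Rightarrow> real ^ 'e \<Rightarrow> real ^ 'e" where
  "curv_gradient ends y = (\<chi> e. \<Sum>x\<in>ends e.
     (2 - real (deg ends x)) * (exp (y $ e) / (\<Sum>f\<in>edges_at ends x. exp (y $ f))))"

lemma curv_gradient_inner:
  "curv_gradient ends y \<bullet> h = (\<Sum>x\<in>UNIV. (2 - real (deg ends x)) *
     ((\<Sum>f\<in>edges_at ends x. exp (y $ f) * h $ f) / (\<Sum>f\<in>edges_at ends x. exp (y $ f))))"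
proof -
  let ?S = "\<lambda>x. \<Sum>f\<in>edges_at ends x. exp (y $ f)"
  have "curv_gradient ends y \<bullet> h = (\<Sum>e\<in>UNIV. \<Sum>x\<in>{x \<in> UNIV. x \<in> ends e}.
      (2 - real (deg ends x)) * (exp (y $ e) / ?S x) * h $ e)"
    by (simp add: inner_vec_def curv_gradient_def sum_distrib_right)
  also have "\<dots> = (\<Sum>x\<in>UNIV. \<Sum>e\<in>{e \<in> UNIV. x \<in> ends e}.
      (2 - real (deg ends x)) * (exp (y $ e) / ?S x) * h $ e)"
    by (rule sum.swap_restrict) auto
  also have "\<dots> = (\<Sum>x\<in>UNIV. (2 - real (deg ends x)) *
      ((\<Sum>f\<in>edges_at ends x. exp (y $ f) * h $ f) / ?S x))"
    by (simp add: edges_at_def sum_distrib_left sum_divide_distrib mult.assoc)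
  finally show ?thesis .
qed

lemma curv_gradient_shift:
  assumes "\<And>e. y' $ e = y $ e + a"
  shows "curv_gradient ends y' = curv_gradient ends y"
proof -
  have "exp (y' $ e) / (\<Sum>f\<in>F. exp (y' $ f)) = exp (y $ e) / (\<Sum>f\<in>F. exp (y $ f))" for e F
    by (simp add: assms exp_add sum_distrib_right[symmetric])
  then show ?thesis by (simp add: curv_gradient_def)
qed

lemma curvature_on_eq_curv_gradient:
  assumes "\<And>e. 0 < w $ e" "\<And>e. y $ e = - ln (w $ e)"
  shows "curvature_on ends UNIV w e = curv_gradient ends y $ e"
proof -
  have "exp (y $ e) = inverse (w $ e)" for e
    using assms by (simp add: exp_minus)
  then show ?thesis by (simp add: curvature_on_def curv_gradient_def divide_inverse mult.assoc)
qed

context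
  fixes ends :: "'e::finite \<Rightarrow> 'v::finite set"
  assumes nonempty: "\<And>x. edges_at ends x \<noteq> {}"
begin

lemma exp_sum_pos: "0 < (\<Sum>f\<in>edges_at ends x. exp (y f :: real))"
  using nonempty by (intro sum_pos) auto

lemma curv_potential_has_derivative:
  "(curv_potential ends has_derivative (\<lambda>h. curv_gradient ends y \<bullet> h)) (at y)"
proof -
  have S: "((\<lambda>y. \<Sum>f\<in>edges_at ends x. exp (y $ f)) has_derivative
      (\<lambda>h. \<Sum>f\<in>edges_at ends x. exp (y $ f) * h $ f)) (at y)" for x
  proof (rule has_derivative_sum)
    fix f
    have "((\<lambda>y. y $ f) has_derivative (\<lambda>h. h $ f)) (at y)"
      by (rule bounded_linear.has_derivative[OF bounded_linear_vec_nth has_derivative_ident])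
    then show "((\<lambda>y. exp (y $ f)) has_derivative (\<lambda>h. exp (y $ f) * h $ f)) (at y)"
      by (rule has_derivative_eq_rhs[OF has_derivative_exp]) (simp add: mult.commute)
  qed
  have "((\<lambda>y. (2 - real (deg ends x)) * ln (\<Sum>f\<in>edges_at ends x. exp (y $ f))) has_derivative
      (\<lambda>h. (2 - real (deg ends x)) * ((\<Sum>f\<in>edges_at ends x. exp (y $ f) * h $ f) *
          inverse (\<Sum>f\<in>edges_at ends x. exp (y $ f))))) (at y)" for x
    by (rule has_derivative_mult_right[OF has_derivative_ln[OF exp_sum_pos S]])
  then have "((\<lambda>y. \<Sum>x\<in>UNIV. (2 - real (deg ends x)) * ln (\<Sum>f\<in>edges_at ends x. exp (y $ f))) has_derivative
      (\<lambda>h. \<Sum>x\<in>UNIV. (2 - real (deg ends x)) * ((\<Sum>f\<in>edges_at ends x. exp (y $ f) * h $ f) *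
          inverse (\<Sum>f\<in>edges_at ends x. exp (y $ f))))) (at y)"
    by (intro has_derivative_sum)
  moreover have "curv_potential ends = (\<lambda>y. \<Sum>x\<in>UNIV. (2 - real (deg ends x)) * ln (\<Sum>f\<in>edges_at ends x. exp (y $ f)))"
    by (rule ext) (rule curv_potential_def)
  ultimately show ?thesis by (simp add: curv_gradient_inner divide_inverse)
qed

text \<open>Jensen's inequality for the softmax weights, from \<open>exp a \<ge> 1 + a\<close>.\<close>

lemma log_sum_exp_tangent:
  fixes y u :: "'a \<Rightarrow> real"
  assumes E: "finite E" "E \<noteq> {}"
  shows "(\<Sum>f\<in>E. exp (y f) * (u f - y f)) / (\<Sum>f\<in>E. exp (y f))
    \<le> ln (\<Sum>f\<in>E. exp (u f)) - ln (\<Sum>f\<in>E. exp (y f))"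
proof -
  define S where "S = (\<Sum>f\<in>E. exp (y f))"
  \<comment> \<open>The softmax mean of \<open>u - y\<close>. Centring at it makes the linear parts
    of \<open>1 + a\<close> cancel in the weighted sum.\<close>
  define \<delta> where "\<delta> = (\<Sum>f\<in>E. exp (y f) * (u f - y f)) / S"
  have S: "0 < S" unfolding S_def using E by (intro sum_pos) auto
  have U: "0 < (\<Sum>f\<in>E. exp (u f))" using E by (intro sum_pos) auto
  have "S = (\<Sum>f\<in>E. exp (y f) * (1 + (u f - y f - \<delta>)))"
  proof -
    have "(\<Sum>f\<in>E. exp (y f) * (1 + (u f - y f - \<delta>)))
        = S + ((\<Sum>f\<in>E. exp (y f) * (u f - y f)) - S * \<delta>)"
      unfolding S_def sum_distrib_right sum_subtractf[symmetric] sum.distrib[symmetric]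
      by (intro sum.cong) (auto simp: algebra_simps)
    then show ?thesis using S by (simp add: \<delta>_def)
  qed
  also have "\<dots> \<le> (\<Sum>f\<in>E. exp (y f) * exp (u f - y f - \<delta>))"
    by (intro sum_mono mult_left_mono exp_ge_add_one_self) auto
  also have "\<dots> = (\<Sum>f\<in>E. exp (u f)) * exp (- \<delta>)"
    unfolding sum_distrib_right by (intro sum.cong) (simp_all flip: exp_add)
  finally have "S * exp \<delta> \<le> (\<Sum>f\<in>E. exp (u f))"
    using S by (simp add: exp_minus field_simps)
  then have "ln (S * exp \<delta>) \<le> ln (\<Sum>f\<in>E. exp (u f))" using S U by simp
  then have "ln S + \<delta> \<le> ln (\<Sum>f\<in>E. exp (u f))" using S by (simp add: ln_mult)
  then show ?thesis unfolding \<delta>_def S_def by simp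
qed

text \<open>Each log-sum-exp is convex, and a coefficient \<open>2 - deg \<le> 0\<close> makes it
  concave. Only leaves have a positive coefficient; there the logarithm of a single exponential is
  linear and the tangent inequality is an equality.\<close>

lemma curv_potential_concave:
  "curv_potential ends u \<le> curv_potential ends y + curv_gradient ends y \<bullet> (u - y)"
proof -
  let ?L = "\<lambda>u x. ln (\<Sum>f\<in>edges_at ends x. exp ((u :: real ^ 'e) $ f))"
  let ?T = "\<lambda>x. (\<Sum>f\<in>edges_at ends x. exp (y $ f) * (u $ f - y $ f)) / (\<Sum>f\<in>edges_at ends x. exp (y $ f))"
  have "(2 - real (deg ends x)) * (?L u x - ?L y x) \<le> (2 - real (deg ends x)) * ?T x" for x
  proof (cases "deg ends x \<ge> 2")
    case True
    have "?T x \<le> ?L u x - ?L y x"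
      using log_sum_exp_tangent[of "edges_at ends x" "\<lambda>f. y $ f" "\<lambda>f. u $ f"] nonempty by simp
    then show ?thesis using True by (intro mult_left_mono_neg) auto
  next
    case False
    moreover have "card (edges_at ends x) > 0" using nonempty by (simp add: card_gt_0_iff)
    ultimately have "card (edges_at ends x) = 1" by (simp add: deg_def)
    then obtain e where "edges_at ends x = {e}" by (auto simp: card_1_singleton_iff)
    then show ?thesis by simp
  qed
  then have "(\<Sum>x\<in>UNIV. (2 - real (deg ends x)) * (?L u x - ?L y x))
      \<le> (\<Sum>x\<in>UNIV. (2 - real (deg ends x)) * ?T x)"
    by (intro sum_mono)
  then show ?thesis
    by (simp add: curv_potential_def curv_gradient_inner right_diff_distrib sum_subtractf)
qed

end

section \<open>The normalized flow as a shifted gradient flow\<close>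

context
  fixes ends :: "'e::finite \<Rightarrow> 'v::finite set" and w :: "real \<Rightarrow> real ^ 'e"
  assumes tree: "finite_tree ends" and flow: "normalized_flow ends w"
begin

lemma flow_pos: "0 \<le> t \<Longrightarrow> 0 < w t $ e"
  using flow by (simp add: normalized_flow_def)

lemma flow_component:
  assumes "0 \<le> t"
  shows "((\<lambda>t. w t $ e) has_real_derivative
    - (w t $ e * (curvature ends (w t) e - total_curvature ends (w t)))) (at t within {0..})"
proof -
  have "(w has_vector_derivative
        (\<chi> e. - (w t $ e * (curvature ends (w t) e - total_curvature ends (w t)))))
        (at t within {0..})"
    using flow assms by (simp add: normalized_flow_def)
  from bounded_linear.has_vector_derivative[OF bounded_linear_vec_nth this, of e]
  show ?thesis by (simp add: has_real_derivative_iff_has_vector_derivative)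
qed

lemma flow_ln_component:
  assumes "0 \<le> t"
  shows "((\<lambda>t. ln (w t $ e)) has_real_derivative
    total_curvature ends (w t) - curvature ends (w t) e) (at t within {0..})"
  using flow_pos[OF assms, of e]
  by (auto intro!: derivative_eq_intros flow_component[OF assms] simp: field_simps)

lemma sum_curvature:
  assumes "0 \<le> t"
  shows "(\<Sum>e\<in>UNIV. curvature ends (w t) e) = (\<Sum>x\<in>UNIV. 2 - real (deg ends x))"
  using sum_curvature_on[OF tree, of UNIV "w t"] flow_pos[OF assms]
  by (simp add: curvature_eq_curvature_on[OF tree])

text \<open>Obtained by summing the equations for \<open>ln (w $ e)\<close>, in which the curvatures have constant sum.\<close>

definition curvature_integral :: "real \<Rightarrow> real" where
  "curvature_integral t =
     ((\<Sum>x\<in>UNIV. 2 - real (deg ends x)) * t + (\<Sum>e\<in>UNIV. ln (w t $ e))) / real CARD('e)"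

lemma curvature_integral_derivative:
  assumes t: "0 \<le> t"
  shows "(curvature_integral has_real_derivative total_curvature ends (w t)) (at t within {0..})"
proof -
  let ?K = "total_curvature ends (w t)" and ?A = "\<Sum>x\<in>UNIV. 2 - real (deg ends x)"
  have "((\<lambda>t. (\<Sum>e\<in>UNIV. ln (w t $ e))) has_real_derivative (\<Sum>e\<in>UNIV. ?K - curvature ends (w t) e))
      (at t within {0..})"
    by (intro DERIV_sum flow_ln_component[OF t])
  then have "((\<lambda>t. ?A * t + (\<Sum>e\<in>UNIV. ln (w t $ e))) has_real_derivative
      (?A * 1 + (\<Sum>e\<in>UNIV. ?K - curvature ends (w t) e))) (at t within {0..})"
    by (intro DERIV_add DERIV_cmult DERIV_ident)
  then have "(curvature_integral has_real_derivative
      (?A * 1 + (\<Sum>e\<in>UNIV. ?K - curvature ends (w t) e)) / real CARD('e)) (at t within {0..})"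
    unfolding curvature_integral_def[abs_def] by (rule DERIV_cdivide)
  moreover have "(\<Sum>e\<in>UNIV. ?K - curvature ends (w t) e) = real CARD('e) * ?K - ?A"
    by (simp add: sum_subtractf sum_curvature[OF t])
  ultimately show ?thesis by simp
qed

text \<open>The excess of the sum over 1 solves the linear equation with rate
  \<open>total_curvature\<close>, so multiplying it by \<open>exp (- curvature_integral t)\<close>
  gives a constant, which is 0 initially.\<close>

lemma flow_sum:
  assumes "0 \<le> t"
  shows "(\<Sum>e\<in>UNIV. w t $ e) = 1"
proof -
  define h where "h t = ((\<Sum>e\<in>UNIV. w t $ e) - 1) * exp (- curvature_integral t)" for t
  have der: "(h has_real_derivative 0) (at t within {0..})" if t: "0 \<le> t" for t
  proof -
    let ?K = "total_curvature ends (w t)"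
    have "((\<lambda>t. (\<Sum>e\<in>UNIV. w t $ e)) has_real_derivative
        (\<Sum>e\<in>UNIV. - (w t $ e * (curvature ends (w t) e - ?K)))) (at t within {0..})"
      by (intro DERIV_sum flow_component[OF t])
    moreover have "(\<Sum>e\<in>UNIV. - (w t $ e * (curvature ends (w t) e - ?K))) = ?K * ((\<Sum>e\<in>UNIV. w t $ e) - 1)"
      by (simp add: total_curvature_def[of ends "w t"] sum_subtractf right_diff_distrib
          sum_distrib_right[symmetric] sum_negf)
    ultimately have S: "((\<lambda>t. (\<Sum>e\<in>UNIV. w t $ e)) has_real_derivative ?K * ((\<Sum>e\<in>UNIV. w t $ e) - 1))
        (at t within {0..})" by simp
    show ?thesis unfolding h_def[abs_def]
      by (rule derivative_eq_intros S curvature_integral_derivative[OF t] refl)+ (simp add: algebra_simps)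
  qed
  have "h t = h 0"
  proof (rule antisym)
    show "h 0 \<le> h t" by (rule nonneg_derivative_imp_le[OF der]) (use assms in auto)
    have "- h 0 \<le> - h t"
      by (rule nonneg_derivative_imp_le[OF DERIV_minus[OF der]]) (use assms in auto)
    then show "h t \<le> h 0" by simp
  qed
  then show ?thesis using flow by (simp add: h_def normalized_flow_def)
qed

theorem curvature_converges: "\<exists>c. \<forall>e. ((\<lambda>t. curvature ends (w t) e) \<longlongrightarrow> c e) at_top"
proof -
  \<comment> \<open>Adding the antiderivative of the total curvature to \<open>- ln w\<close>
    cancels the normalizing term in the derivative; what remains is the vector of
    curvatures.\<close>
  define z where "z t = (\<chi> e. curvature_integral t - ln (w t $ e))" for t
  have g: "curv_gradient ends (z t) $ e = curvature ends (w t) e" if "0 \<le> t" for t e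
  proof -
    have "curv_gradient ends (z t) = curv_gradient ends (\<chi> e. - ln (w t $ e))"
      by (rule curv_gradient_shift[where a = "curvature_integral t"]) (simp add: z_def)
    then show ?thesis
      using curvature_on_eq_curv_gradient[of "w t" "\<chi> e. - ln (w t $ e)" ends e] flow_pos[OF that]
      by (simp add: curvature_eq_curvature_on[OF tree])
  qed
  have z: "(z has_vector_derivative curv_gradient ends (z t)) (at t within {0..})" if t: "0 \<le> t" for t
  proof -
    have "((\<lambda>t. curvature_integral t - ln (w t $ e)) has_real_derivative curvature ends (w t) e)
        (at t within {0..})" for e
      using DERIV_diff[OF curvature_integral_derivative[OF t] flow_ln_component[OF t, of e]] by simp
    then have "((\<lambda>t. \<Sum>e\<in>UNIV. (curvature_integral t - ln (w t $ e)) *\<^sub>R axis e 1) has_vector_derivative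
        (\<Sum>e\<in>UNIV. curvature ends (w t) e *\<^sub>R (axis e 1 :: real ^ 'e))) (at t within {0..})"
      unfolding has_real_derivative_iff_has_vector_derivative
      by (intro has_vector_derivative_sum bounded_linear.has_vector_derivative[OF bounded_linear_scaleR_left])
    moreover have "z t = (\<Sum>e\<in>UNIV. (curvature_integral t - ln (w t $ e)) *\<^sub>R axis e 1)" for t
      using basis_expansion[of "z t"] by (simp add: z_def scalar_mult_eq_scaleR)
    then have "z = (\<lambda>t. \<Sum>e\<in>UNIV. (curvature_integral t - ln (w t $ e)) *\<^sub>R axis e 1)" by (rule ext)
    moreover have "curv_gradient ends (z t) = (\<Sum>e\<in>UNIV. curvature ends (w t) e *\<^sub>R axis e 1)"
      using basis_expansion[of "curv_gradient ends (z t)"] g[OF t] by (simp add: scalar_mult_eq_scaleR)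
    ultimately show ?thesis by metis
  qed
  note ne = finite_tree_edges_at_nonempty[OF tree]
  obtain v where v: "((\<lambda>t. curv_gradient ends (z t)) \<longlongrightarrow> v) at_top"
    using gradient_flow_gradient_converges[OF curv_potential_has_derivative[OF ne] curv_potential_concave[OF ne] z]
    by blast
  have "((\<lambda>t. curvature ends (w t) e) \<longlongrightarrow> v $ e) at_top" for e
  proof (rule Lim_transform_eventually)
    show "((\<lambda>t. curv_gradient ends (z t) $ e) \<longlongrightarrow> v $ e) at_top" by (rule tendsto_vec_nth[OF v])
    show "eventually (\<lambda>t. curv_gradient ends (z t) $ e = curvature ends (w t) e) at_top"
      using g by (intro eventually_at_top_linorderI[of 0]) auto
  qed
  then show ?thesis by blast
qed

end

section \<open>Omega-limit points\<close>

lemma const_curv_set_connected_unique: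
  fixes ends :: "'e::finite \<Rightarrow> 'v::finite set"
  assumes conn: "gconnected C (GC_adj ends C)"
    and p: "p \<in> const_curv_set ends C c" and q: "q \<in> const_curv_set ends C c"
  shows "p = q"
proof -
  have "C \<in> gcomponents C (GC_adj ends C)" using gconnected_GC_components[OF conn] by simp
  then obtain a where a: "\<And>e. e \<in> C \<Longrightarrow> p $ e = a * q $ e"
    using const_curv_ratio[OF _ p q] by blast
  have "(\<Sum>e\<in>C. p $ e) = a * (\<Sum>e\<in>C. q $ e)"
    unfolding sum_distrib_left using a by (intro sum.cong) auto
  then have "a = 1" using p q by (simp add: const_curv_set_def simplex_on_def)
  have "p $ e = q $ e" for e
  proof (cases "e \<in> C")
    case True
    then show ?thesis using a \<open>a = 1\<close> by simp
  next
    case False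
    then show ?thesis using p q by (simp add: const_curv_set_def simplex_on_def)
  qed
  then show ?thesis by (simp add: vec_eq_iff)
qed

text \<open>Eventually the derivative is below \<open>d / 2\<close>, so \<open>r\<close> stays under
  a line of negative slope.\<close>

lemma exp_decay_tendsto_0:
  fixes r :: "real \<Rightarrow> real"
  assumes der: "\<And>t. 0 \<le> t \<Longrightarrow> (r has_real_derivative r' t) (at t within {0..})"
    and lim: "(r' \<longlongrightarrow> d) at_top" and d: "d < 0"
  shows "((\<lambda>t. exp (r t)) \<longlongrightarrow> 0) at_top"
proof -
  have "eventually (\<lambda>t. r' t < d / 2) at_top"
    using order_tendstoD(2)[OF lim, of "d / 2"] d by simp
  then obtain T0 where T0: "\<And>t. T0 \<le> t \<Longrightarrow> r' t < d / 2" by (auto simp: eventually_at_top_linorder)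
  define T where "T = max 0 T0"
  have le: "r t \<le> r T + d / 2 * (t - T)" if "T \<le> t" for t
  proof -
    have "d / 2 * T - r T \<le> d / 2 * t - r t"
    proof (rule nonneg_derivative_imp_le[OF _ _ order_refl that])
      fix s assume s: "T \<le> s"
      have "(r has_real_derivative r' s) (at s within {T..})"
        using der[of s] s by (auto simp: T_def intro: DERIV_subset)
      then show "((\<lambda>t. d / 2 * t - r t) has_real_derivative d / 2 - r' s) (at s within {T..})"
        by (auto intro!: derivative_eq_intros)
      show "0 \<le> d / 2 - r' s" using T0[of s] s by (simp add: T_def)
    qed
    moreover have "d / 2 * (t - T) = d / 2 * t - d / 2 * T" by (rule right_diff_distrib)
    ultimately show ?thesis by linarith
  qed
  have "filterlim (\<lambda>t. d / 2 * (t - T)) at_bot at_top"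
  proof (rule filterlim_tendsto_neg_mult_at_bot[OF tendsto_const])
    show "filterlim (\<lambda>t. t - T) at_top at_top"
      using filterlim_tendsto_add_at_top[OF tendsto_const[of "- T"] filterlim_ident] by simp
  qed (use d in simp)
  then have "((\<lambda>t. exp (d / 2 * (t - T))) \<longlongrightarrow> 0) at_top"
    by (rule filterlim_compose[OF exp_at_bot])
  then have "((\<lambda>t. exp (r T + d / 2 * (t - T))) \<longlongrightarrow> 0) at_top"
    unfolding exp_add by (rule tendsto_mult_right_zero)
  moreover have "eventually (\<lambda>t. norm (exp (r t)) \<le> exp (r T + d / 2 * (t - T))) at_top"
    using le by (intro eventually_at_top_linorderI[of T]) simp
  ultimately show ?thesis by (rule Lim_null_comparison[rotated])
qed

context
  fixes ends :: "'e::finite \<Rightarrow> 'v::finite set" and w :: "real \<Rightarrow> real ^ 'e"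
  assumes tree: "finite_tree ends" and flow: "normalized_flow ends w"
begin

lemma flow_le_1:
  assumes "0 \<le> t"
  shows "w t $ e \<le> 1"
proof -
  have "w t $ e \<le> (\<Sum>e\<in>UNIV. w t $ e)"
    using flow_pos[OF tree flow assms] by (intro member_le_sum) (auto intro: less_imp_le)
  then show ?thesis using flow_sum[OF tree flow assms] by simp
qed

lemma flow_continuous: "continuous_on {0..} w"
  unfolding continuous_on_eq_continuous_within
  using flow by (auto simp: normalized_flow_def intro: has_vector_derivative_continuous)

text \<open>The trajectory is bounded, and the closed simplex contains its limits. The condition
  \<open>real n \<le> u n\<close> sends the times to infinity along every subsequence.\<close>

lemma flow_cluster_point:
  assumes u: "\<And>n. real n \<le> u n"
  obtains q r where "strict_mono r" "(\<lambda>n. w (u (r n))) \<longlonglongrightarrow> q" "omega_limit_point w q"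
proof -
  have u0: "0 \<le> u n" for n using u[of n] by simp
  have "norm (w (u n)) \<le> 1" for n
  proof -
    have "norm (w (u n)) \<le> (\<Sum>e\<in>UNIV. \<bar>w (u n) $ e\<bar>)" by (rule norm_le_l1_cart)
    also have "\<dots> = (\<Sum>e\<in>UNIV. w (u n) $ e)"
      using flow_pos[OF tree flow u0] by (intro sum.cong) (auto intro!: abs_of_pos)
    finally show ?thesis using flow_sum[OF tree flow u0] by simp
  qed
  then have "bounded (range (\<lambda>n. w (u n)))" by (auto simp: bounded_iff)
  then obtain q r where r: "strict_mono r" and q: "((\<lambda>n. w (u n)) \<circ> r) \<longlonglongrightarrow> q"
    using bounded_imp_convergent_subsequence by blast
  then have lim: "(\<lambda>n. w (u (r n))) \<longlonglongrightarrow> q" by (simp add: o_def)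
  have "0 \<le> q $ e" for e
    by (rule LIMSEQ_le_const[OF tendsto_vec_nth[OF lim]])
      (use flow_pos[OF tree flow u0] in \<open>auto intro: less_imp_le\<close>)
  moreover have "(\<Sum>e\<in>UNIV. q $ e) = 1"
  proof (rule LIMSEQ_unique)
    show "(\<lambda>n. \<Sum>e\<in>UNIV. w (u (r n)) $ e) \<longlonglongrightarrow> (\<Sum>e\<in>UNIV. q $ e)"
      by (intro tendsto_sum tendsto_vec_nth lim)
    show "(\<lambda>n. \<Sum>e\<in>UNIV. w (u (r n)) $ e) \<longlonglongrightarrow> 1"
      using flow_sum[OF tree flow u0] by simp
  qed
  moreover have "filterlim (\<lambda>n. u (r n)) at_top sequentially"
  proof (rule filterlim_at_top_mono[OF filterlim_real_sequentially])
    have "real n \<le> u (r n)" for n using u[of "r n"] seq_suble[OF r, of n] by linarith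
    then show "eventually (\<lambda>n. real n \<le> u (r n)) sequentially" by simp
  qed
  ultimately have "omega_limit_point w q" using lim by (auto simp: omega_limit_point_def)
  then show ?thesis using that r lim by blast
qed

text \<open>A bounded trajectory that accumulated elsewhere too would cross a small sphere around an
  isolated omega-limit point at arbitrarily large times, and so have a limit point on it.\<close>

lemma isolated_omega_limit_point_imp_tendsto:
  assumes q: "omega_limit_point w q" and \<epsilon>: "0 < \<epsilon>"
    and iso: "\<And>q'. omega_limit_point w q' \<Longrightarrow> dist q' q \<le> \<epsilon> \<Longrightarrow> q' = q"
  shows "(w \<longlongrightarrow> q) at_top"
proof (rule ccontr)
  assume "\<not> (w \<longlongrightarrow> q) at_top"
  then obtain \<delta>0 where \<delta>0: "0 < \<delta>0" "\<not> eventually (\<lambda>t. dist (w t) q < \<delta>0) at_top"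
    by (auto simp: tendsto_iff)
  \<comment> \<open>At most \<open>\<delta>0\<close>, so that the trajectory keeps leaving the ball,
    and at most \<epsilon>, so that the sphere lies where \<open>q\<close> is isolated.\<close>
  define \<delta> where "\<delta> = min \<delta>0 \<epsilon>"
  have \<delta>: "0 < \<delta>" "\<delta> \<le> \<epsilon>" using \<delta>0 \<epsilon> by (auto simp: \<delta>_def)
  have far: "\<exists>t\<ge>T. \<delta> \<le> dist (w t) q" for T
    using \<delta>0(2) by (force simp: eventually_at_top_linorder \<delta>_def)
  have near: "\<exists>t\<ge>T. dist (w t) q < \<delta>" for T
  proof -
    obtain \<tau> where \<tau>: "filterlim \<tau> at_top sequentially" "(\<lambda>j. w (\<tau> j)) \<longlonglongrightarrow> q"
      using q by (auto simp: omega_limit_point_def)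
    have "eventually (\<lambda>j. T \<le> \<tau> j) sequentially" using \<tau>(1) by (simp add: filterlim_at_top)
    moreover have "eventually (\<lambda>j. dist (w (\<tau> j)) q < \<delta>) sequentially" using tendstoD[OF \<tau>(2) \<delta>(1)] .
    ultimately have "eventually (\<lambda>j. T \<le> \<tau> j \<and> dist (w (\<tau> j)) q < \<delta>) sequentially"
      by (rule eventually_conj)
    then show ?thesis using eventually_happens[of _ sequentially] by fastforce
  qed
  have "\<exists>u\<ge>real n. dist (w u) q = \<delta>" for n
  proof -
    obtain s where s: "real n \<le> s" "dist (w s) q < \<delta>" using near by blast
    obtain t where t: "s \<le> t" "\<delta> \<le> dist (w t) q" using far by blast
    have "continuous_on {s..t} w"
      using continuous_on_subset[OF flow_continuous, of "{s..t}"] s by auto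
    then have "continuous_on {s..t} (\<lambda>t. dist (w t) q)" by (intro continuous_intros)
    then obtain u where "s \<le> u" "dist (w u) q = \<delta>"
      using IVT'[of "\<lambda>t. dist (w t) q" s \<delta> t] s t by auto
    then show ?thesis using s by (intro exI[of _ u]) auto
  qed
  then obtain u where u: "\<And>n. real n \<le> u n" "\<And>n. dist (w (u n)) q = \<delta>" by metis
  obtain q' r where r: "(\<lambda>n. w (u (r n))) \<longlonglongrightarrow> q'" and q': "omega_limit_point w q'"
    using flow_cluster_point[OF u(1)] by blast
  have "(\<lambda>n. dist (w (u (r n))) q) \<longlonglongrightarrow> dist q' q" by (intro tendsto_intros r)
  then have "dist q' q = \<delta>" using u(2) by (simp add: LIMSEQ_const_iff)
  then show False using iso[OF q'] \<delta> by auto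
qed

text \<open>Vertices whose edges all survive contribute by continuity. At any other end of
  \<open>e\<close> some edge \<open>f\<close> has limit weight 0; its inverse weight alone bounds
  the sum from below, so the contribution is at most a multiple of \<open>w $ f / w $ e\<close>,
  which vanishes because \<open>e\<close> survives.\<close>

lemma omega_limit_curvature:
  assumes \<tau>: "filterlim \<tau> at_top sequentially" "(\<lambda>j. w (\<tau> j)) \<longlonglongrightarrow> q"
    and q: "\<And>e. 0 \<le> q $ e" and e: "e \<in> pos_support q"
  shows "(\<lambda>j. curvature ends (w (\<tau> j)) e) \<longlonglongrightarrow> curvature_on ends (pos_support q) q e"
proof -
  let ?C = "pos_support q"
  let ?t = "\<lambda>w x. (2 - real (deg ends x)) / (w $ e * (\<Sum>f\<in>edges_at ends x. inverse (w $ f)))"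
  have qe: "0 < q $ e" using e by (simp add: pos_support_def)
  have ev: "eventually (\<lambda>j. 0 \<le> \<tau> j) sequentially" using \<tau>(1) by (simp add: filterlim_at_top)
  note lim = tendsto_vec_nth[OF \<tau>(2)]
  have term_lim: "(\<lambda>j. ?t (w (\<tau> j)) x) \<longlonglongrightarrow> (if edges_at ends x \<subseteq> ?C then ?t q x else 0)"
    if x: "x \<in> ends e" for x
  proof (cases "edges_at ends x \<subseteq> ?C")
    case True
    have pos: "0 < q $ f" if "f \<in> edges_at ends x" for f using True that by (auto simp: pos_support_def)
    then have "0 < (\<Sum>f\<in>edges_at ends x. inverse (q $ f))"
      using x by (intro sum_pos) (auto simp: edges_at_def)
    then have "(\<lambda>j. ?t (w (\<tau> j)) x) \<longlonglongrightarrow> ?t q x"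
      using pos qe by (intro tendsto_intros lim) (auto dest: pos)
    then show ?thesis using True by simp
  next
    case False
    then obtain f where f: "f \<in> edges_at ends x" "f \<notin> ?C" by blast
    then have qf: "q $ f = 0" using q[of f] by (simp add: pos_support_def)
    have "(\<lambda>j. \<bar>2 - real (deg ends x)\<bar> * (w (\<tau> j) $ f / w (\<tau> j) $ e)) \<longlonglongrightarrow>
        \<bar>2 - real (deg ends x)\<bar> * (q $ f / q $ e)"
      using qe by (intro tendsto_intros lim) auto
    then have "(\<lambda>j. \<bar>2 - real (deg ends x)\<bar> * (w (\<tau> j) $ f / w (\<tau> j) $ e)) \<longlonglongrightarrow> 0"
      by (simp only: qf div_0 mult_zero_right)
    moreover have "eventually (\<lambda>j. norm (?t (w (\<tau> j)) x)
        \<le> \<bar>2 - real (deg ends x)\<bar> * (w (\<tau> j) $ f / w (\<tau> j) $ e)) sequentially"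
      using ev
    proof (rule eventually_mono)
      fix j assume j: "0 \<le> \<tau> j"
      define p where "p = w (\<tau> j)"
      have p: "0 < p $ g" for g using flow_pos[OF tree flow j] by (simp add: p_def)
      have "inverse (p $ f) \<le> (\<Sum>f\<in>edges_at ends x. inverse (p $ f))"
        using f p by (intro member_le_sum) (auto intro: less_imp_le)
      then have "p $ e * inverse (p $ f) \<le> p $ e * (\<Sum>f\<in>edges_at ends x. inverse (p $ f))"
        using p[of e] by (intro mult_left_mono) auto
      moreover have "0 < p $ e * inverse (p $ f)" using p by simp
      ultimately have "norm (?t p x) \<le> \<bar>2 - real (deg ends x)\<bar> / (p $ e * inverse (p $ f))"
        by (simp add: abs_divide) (intro divide_left_mono, auto)
      also have "\<dots> = \<bar>2 - real (deg ends x)\<bar> * (p $ f / p $ e)" by (simp add: divide_inverse)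
      finally show "norm (?t (w (\<tau> j)) x) \<le> \<bar>2 - real (deg ends x)\<bar> * (w (\<tau> j) $ f / w (\<tau> j) $ e)"
        by (simp add: p_def)
    qed
    ultimately have "(\<lambda>j. ?t (w (\<tau> j)) x) \<longlonglongrightarrow> 0"
      by (rule Lim_null_comparison[rotated])
    then show ?thesis using False by simp
  qed
  have "(\<lambda>j. \<Sum>x\<in>ends e. ?t (w (\<tau> j)) x) \<longlonglongrightarrow>
      (\<Sum>x\<in>ends e. if edges_at ends x \<subseteq> ?C then ?t q x else 0)"
    by (intro tendsto_sum term_lim)
  moreover have "(\<Sum>x\<in>ends e. if edges_at ends x \<subseteq> ?C then ?t q x else 0) = curvature_on ends ?C q e"
    unfolding curvature_on_def by (intro sum.inter_filter[symmetric]) simp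
  ultimately have "(\<lambda>j. \<Sum>x\<in>ends e. ?t (w (\<tau> j)) x) \<longlonglongrightarrow> curvature_on ends ?C q e" by simp
  then show ?thesis
  proof (rule Lim_transform_eventually)
    show "eventually (\<lambda>j. (\<Sum>x\<in>ends e. ?t (w (\<tau> j)) x) = curvature ends (w (\<tau> j)) e) sequentially"
      using ev
    proof (rule eventually_mono)
      fix j assume "0 \<le> \<tau> j"
      then have "curvature ends (w (\<tau> j)) e = curvature_on ends UNIV (w (\<tau> j)) e"
        using flow_pos[OF tree flow] by (intro curvature_eq_curvature_on[OF tree])
      then show "(\<Sum>x\<in>ends e. ?t (w (\<tau> j)) x) = curvature ends (w (\<tau> j)) e"
        by (simp add: curvature_on_def)
    qed
  qed
qed

context
  fixes c :: "'e \<Rightarrow> real"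
  assumes c: "\<And>e. ((\<lambda>t. curvature ends (w t) e) \<longlongrightarrow> c e) at_top"
begin

lemma limit_curvature_eq: "limit_curvature ends w e = c e"
  unfolding limit_curvature_def by (rule tendsto_Lim[OF _ c]) simp

text \<open>The normalizing term cancels in \<open>ln (w $ e) - ln (w $ f)\<close>, whose derivative
  tends to \<open>c f - c e < 0\<close>. Since \<open>w $ f \<le> 1\<close>, the decay of the ratio
  bounds \<open>w $ e\<close> itself.\<close>

lemma flow_tendsto_0:
  assumes "c f < c e"
  shows "((\<lambda>t. w t $ e) \<longlongrightarrow> 0) at_top"
proof -
  have "((\<lambda>t. exp (ln (w t $ e) - ln (w t $ f))) \<longlongrightarrow> 0) at_top"
  proof (rule exp_decay_tendsto_0)
    show "((\<lambda>t. ln (w t $ e) - ln (w t $ f)) has_real_derivative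
        curvature ends (w t) f - curvature ends (w t) e) (at t within {0..})" if "0 \<le> t" for t
      using DERIV_diff[OF flow_ln_component[OF tree flow that, of e] flow_ln_component[OF tree flow that, of f]]
      by simp
    show "((\<lambda>t. curvature ends (w t) f - curvature ends (w t) e) \<longlongrightarrow> c f - c e) at_top"
      by (intro tendsto_intros c)
  qed (use assms in simp)
  moreover have "eventually (\<lambda>t. norm (w t $ e) \<le> exp (ln (w t $ e) - ln (w t $ f))) at_top"
  proof (rule eventually_at_top_linorderI[of 0])
    fix t :: real assume t: "0 \<le> t"
    have "exp (ln (w t $ e) - ln (w t $ f)) = w t $ e / w t $ f"
      using flow_pos[OF tree flow t] by (simp add: exp_diff)
    moreover have "w t $ e / 1 \<le> w t $ e / w t $ f"
      using flow_pos[OF tree flow t] flow_le_1[OF t, of f]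
      by (intro divide_left_mono) (auto intro: less_imp_le)
    ultimately show "norm (w t $ e) \<le> exp (ln (w t $ e) - ln (w t $ f))"
      using flow_pos[OF tree flow t, of e] by simp
  qed
  ultimately show ?thesis by (rule Lim_null_comparison[rotated])
qed

lemma omega_limit_point_minimal:
  assumes q: "omega_limit_point w q" and e: "e \<in> pos_support q"
  shows "c e = Min (range c)"
proof (rule ccontr)
  assume neq: "c e \<noteq> Min (range c)"
  have "Min (range c) \<in> range c" by (intro Min_in) auto
  then obtain f where f: "Min (range c) = c f" by blast
  have "Min (range c) \<le> c e" by (intro Min_le) auto
  then have "c f < c e" using neq unfolding f by (intro order.not_eq_order_implies_strict) auto
  then have lim: "((\<lambda>t. w t $ e) \<longlongrightarrow> 0) at_top" by (rule flow_tendsto_0)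
  obtain \<tau> where \<tau>: "filterlim \<tau> at_top sequentially" "(\<lambda>j. w (\<tau> j)) \<longlonglongrightarrow> q"
    using q by (auto simp: omega_limit_point_def)
  have "(\<lambda>j. w (\<tau> j) $ e) \<longlonglongrightarrow> 0" by (rule filterlim_compose[OF lim \<tau>(1)])
  then have "q $ e = 0" using tendsto_vec_nth[OF \<tau>(2)] LIMSEQ_unique by blast
  then show False using e by (simp add: pos_support_def)
qed

lemma omega_limit_point_const_curv:
  assumes "omega_limit_point w q"
  shows "q \<in> const_curv_set ends (pos_support q) (Min (range c))"
proof -
  obtain \<tau> where \<tau>: "filterlim \<tau> at_top sequentially" "(\<lambda>j. w (\<tau> j)) \<longlonglongrightarrow> q"
    and q: "\<And>e. 0 \<le> q $ e" "(\<Sum>e\<in>UNIV. q $ e) = 1"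
    using assms by (auto simp: omega_limit_point_def)
  have zero: "q $ e = 0" if "e \<notin> pos_support q" for e
    using q(1)[of e] that by (simp add: pos_support_def)
  have "(\<Sum>e\<in>pos_support q. q $ e) = (\<Sum>e\<in>UNIV. q $ e)"
    using zero by (intro sum.mono_neutral_left) auto
  moreover have "curvature_on ends (pos_support q) q e = Min (range c)" if "e \<in> pos_support q" for e
    using LIMSEQ_unique[OF omega_limit_curvature[OF \<tau> q(1) that] filterlim_compose[OF c \<tau>(1)]]
      omega_limit_point_minimal[OF assms that] by simp
  moreover have "\<forall>e\<in>pos_support q. 0 < q $ e" by (simp add: pos_support_def)
  ultimately show ?thesis
    unfolding const_curv_set_def simplex_on_def using q(2) zero by fastforce
qed

end

theorem flow_tendsto_omega_limit_point:
  assumes q: "omega_limit_point w q"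
    and max: "\<And>q'. omega_limit_point w q' \<Longrightarrow> card (pos_support q') \<le> card (pos_support q)"
    and conn: "gconnected (pos_support q) (GC_adj ends (pos_support q))"
  shows "(w \<longlongrightarrow> q) at_top"
proof -
  let ?C = "pos_support q"
  obtain c where c: "\<And>e. ((\<lambda>t. curvature ends (w t) e) \<longlongrightarrow> c e) at_top"
    using curvature_converges[OF tree flow] by blast
  \<comment> \<open>The smallest positive weight of \<open>q\<close>. A limit point within
    \<open>m / 2\<close> keeps all edges of \<open>?C\<close> positive, and the maximality of
    \<open>card ?C\<close> then forces the same support.\<close>
  define m where "m = Min ((\<lambda>e. q $ e) ` ?C)"
  have ne: "?C \<noteq> {}" using conn by (simp add: gconnected_def)
  have m_le: "m \<le> q $ e" if "e \<in> ?C" for e using that by (simp add: m_def)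
  have "m \<in> (\<lambda>e. q $ e) ` ?C" unfolding m_def using ne by (intro Min_in) auto
  then have m: "0 < m" by (auto simp: pos_support_def)
  show ?thesis
  proof (rule isolated_omega_limit_point_imp_tendsto[OF q, of "m / 2"])
    fix q' assume q': "omega_limit_point w q'" "dist q' q \<le> m / 2"
    have "?C \<subseteq> pos_support q'"
    proof
      fix e assume e: "e \<in> ?C"
      have "\<bar>q' $ e - q $ e\<bar> \<le> m / 2"
        using component_le_norm_cart[of "q' - q" e] q'(2) by (simp add: dist_norm)
      then have "0 < q' $ e" using m m_le[OF e] by linarith
      then show "e \<in> pos_support q'" by (simp add: pos_support_def)
    qed
    then have "pos_support q' = ?C" using max[OF q'(1)] by (metis card_seteq finite)
    then have "q' \<in> const_curv_set ends ?C (Min (range c))"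
      using omega_limit_point_const_curv[OF c q'(1)] by simp
    then show "q' = q"
      by (rule const_curv_set_connected_unique[OF conn _ omega_limit_point_const_curv[OF c q]])
  qed (use m in simp)
qed

text \<open>A limit point whose support is all of \<open>min_limit_edges\<close> therefore has
  maximal support, which reduces the last claim to the general one.\<close>

lemma omega_limit_point_support_subset:
  assumes "omega_limit_point w q"
  shows "pos_support q \<subseteq> min_limit_edges ends w"
proof
  fix e assume e: "e \<in> pos_support q"
  obtain c where c: "\<And>e. ((\<lambda>t. curvature ends (w t) e) \<longlongrightarrow> c e) at_top"
    using curvature_converges[OF tree flow] by blast
  have "limit_curvature ends w = c" using limit_curvature_eq[OF c] by blast
  then show "e \<in> min_limit_edges ends w"
    using omega_limit_point_minimal[OF c assms e] by (simp add: min_limit_edges_def)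
qed

end

theorem theorem1p5:
  fixes ends :: "'e::finite \<Rightarrow> 'v::finite set"
  assumes "finite_tree ends"
  shows
    "(\<forall>(C :: 'e set) (c :: real). C \<noteq> {} \<longrightarrow>
        (\<forall>p \<in> const_curv_set ends C c.
           real (card C) * c = (\<Sum>x \<in> {x. edges_at ends x \<subseteq> C}. 2 - real (deg ends x))) \<and>
        (\<forall>c'. const_curv_set ends C c \<noteq> {} \<and> const_curv_set ends C c' \<noteq> {} \<longrightarrow> c = c') \<and>
        (\<forall>(s :: nat) (D :: nat \<Rightarrow> 'e set).
           bij_betw D {1..s} (gcomponents C (GC_adj ends C)) \<and> const_curv_set ends C c \<noteq> {} \<longrightarrow>
             (\<exists>!q :: nat \<Rightarrow> real ^ 'e.
                q \<in> (\<Pi>\<^sub>E i\<in>{1..s}. simplex_on (D i)) \<and>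
                const_curv_set ends C c =
                  {(\<Sum>i=1..s. \<theta> i *\<^sub>R q i) | \<theta> :: nat \<Rightarrow> real.
                     (\<forall>i\<in>{1..s}. 0 < \<theta> i) \<and> (\<Sum>i=1..s. \<theta> i) = 1}) \<and>
             (gconnected C (GC_adj ends C) \<longrightarrow> (\<exists>p. const_curv_set ends C c = {p})) \<and>
             (\<not> gconnected C (GC_adj ends C) \<longrightarrow>
                (\<exists>S. (int s - 1) simplex S \<and> const_curv_set ends C c = rel_interior S)))) \<and>
     (\<forall>(w :: real \<Rightarrow> real ^ 'e) wstar.
        normalized_flow ends w \<and> omega_limit_point w wstar \<longrightarrow>
          ((\<forall>q. omega_limit_point w q \<longrightarrow> card (pos_support q) \<le> card (pos_support wstar)) \<and>
           gconnected (pos_support wstar) (GC_adj ends (pos_support wstar))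
             \<longrightarrow> (w \<longlongrightarrow> wstar) at_top) \<and>
          (pos_support wstar = min_limit_edges ends w \<and>
           gconnected (min_limit_edges ends w) (GC_adj ends (min_limit_edges ends w))
             \<longrightarrow> (w \<longlongrightarrow> wstar) at_top))"
proof (intro conjI allI impI ballI; (elim conjE)?)
  fix C :: "'e set" and c p
  assume "p \<in> const_curv_set ends C c"
  then show "real (card C) * c = (\<Sum>x \<in> {x. edges_at ends x \<subseteq> C}. 2 - real (deg ends x))"
    by (rule const_curv_value[OF assms])
next
  fix C :: "'e set" and c c' :: real
  assume C: "C \<noteq> {}" and "const_curv_set ends C c \<noteq> {}" "const_curv_set ends C c' \<noteq> {}"
  then obtain p p' where "p \<in> const_curv_set ends C c" "p' \<in> const_curv_set ends C c'" by blast
  from this[THEN const_curv_value[OF assms]] have "real (card C) * c = real (card C) * c'" by simp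
  then show "c = c'" using C by simp
next
  fix C :: "'e set" and c :: real and s :: nat and D :: "nat \<Rightarrow> 'e set"
  assume C: "C \<noteq> {}" and D: "bij_betw D {1..s} (gcomponents C (GC_adj ends C))"
    and "const_curv_set ends C c \<noteq> {}"
  then obtain p where p: "p \<in> const_curv_set ends C c" by blast
  let ?S = "\<lambda>q :: nat \<Rightarrow> real ^ 'e. {(\<Sum>i=1..s. \<theta> i *\<^sub>R q i) | \<theta> :: nat \<Rightarrow> real.
     (\<forall>i\<in>{1..s}. 0 < \<theta> i) \<and> (\<Sum>i=1..s. \<theta> i) = 1}"
  obtain q where q: "q \<in> (\<Pi>\<^sub>E i\<in>{1..s}. simplex_on (D i))" "const_curv_set ends C c = ?S q"
    using const_curv_set_decomposition[OF D _ p] by auto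
  have comp: "D i \<in> gcomponents C (GC_adj ends C)" if "i \<in> {1..s}" for i
    using D that by (auto simp: bij_betw_def)
  have disj: "D i \<inter> D j = {}" if "i \<in> {1..s}" "j \<in> {1..s}" "i \<noteq> j" for i j
    using GC_components_disjoint[OF comp comp] D that by (metis bij_betw_def inj_onD)
  have ne: "D i \<noteq> {}" if "i \<in> {1..s}" for i using GC_components_nonempty[OF comp[OF that]] .
  \<comment> \<open>A nonempty \<open>C\<close> has a component, so \<open>s\<close> is at least 1,
    and barycentres over the index set make sense.\<close>
  have "gcomponents C (GC_adj ends C) \<noteq> {}" using Union_GC_components[of C ends] C by auto
  then have I: "finite {1..s}" "{1..s} \<noteq> {}" using D by (auto simp: bij_betw_def)
  show "\<exists>!q. q \<in> (\<Pi>\<^sub>E i\<in>{1..s}. simplex_on (D i)) \<and> const_curv_set ends C c = ?S q"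
  proof (rule ex1I)
    show "q \<in> (\<Pi>\<^sub>E i\<in>{1..s}. simplex_on (D i)) \<and> const_curv_set ends C c = ?S q" using q by blast
  next
    fix q' assume "q' \<in> (\<Pi>\<^sub>E i\<in>{1..s}. simplex_on (D i)) \<and> const_curv_set ends C c = ?S q'"
    then have q': "q' \<in> (\<Pi>\<^sub>E i\<in>{1..s}. simplex_on (D i))" "?S q' \<subseteq> ?S q" using q(2) by auto
    show "q' = q" by (rule simplex_decomposition_unique[OF disj ne I q(1) q'])
  qed
  show "\<exists>p. const_curv_set ends C c = {p}" if "gconnected C (GC_adj ends C)"
    using const_curv_set_connected_unique[OF \<open>gconnected C (GC_adj ends C)\<close>] p by blast
  show "\<exists>S. (int s - 1) simplex S \<and> const_curv_set ends C c = rel_interior S"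
    using simplex_combinations_open_simplex[OF disj ne I q(1)] q(2) by simp
next
  fix w :: "real \<Rightarrow> real ^ 'e" and wstar
  assume "normalized_flow ends w" "omega_limit_point w wstar"
    and "\<forall>q. omega_limit_point w q \<longrightarrow> card (pos_support q) \<le> card (pos_support wstar)"
    and "gconnected (pos_support wstar) (GC_adj ends (pos_support wstar))"
  then show "(w \<longlongrightarrow> wstar) at_top"
    using flow_tendsto_omega_limit_point[OF assms] by blast
next
  fix w :: "real \<Rightarrow> real ^ 'e" and wstar
  assume w: "normalized_flow ends w" and q: "omega_limit_point w wstar"
    and E: "pos_support wstar = min_limit_edges ends w"
    and conn: "gconnected (min_limit_edges ends w) (GC_adj ends (min_limit_edges ends w))"
  show "(w \<longlongrightarrow> wstar) at_top"
  proof (rule flow_tendsto_omega_limit_point[OF assms w q])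
    show "card (pos_support q') \<le> card (pos_support wstar)" if "omega_limit_point w q'" for q'
      using omega_limit_point_support_subset[OF assms w that] E by (simp add: card_mono)
  qed (use E conn in simp)
qed

end
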